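(* Let $\mathcal L_C'$ be the dual poset of $\mathcal L_C$, i.e. $\beta$ covers $\gamma$ in $\mathcal L_C'$ if and only if $\gamma$ covers $\beta$ in $\mathcal L_C$. Let $P$ be the poset $\mathcal L_C'$ with each cover edge labeled $$x\xrightarrow{\;(-i,-j)\;}\tilde x,$$ where $i$ (respectively $j$) is the column (respectively row) index, using cartesian coordinates (rows numbered from bottom to top starting with 1), of the cell appearing in $x$ but not in $\tilde x$. Let these labels be totally ordered by: $(i,j)<(k,\ell)$ if and only if $i<k$, or ($i=k=-1$ and $j>\ell$), or ($i=k<-1$ and $j<\ell$). Then, considering the descent Pieri operator on $P$, for every interval $[\gamma,\beta]$ of $P$ we have $$K_{[\gamma,\beta]}=\mathcal S_{\gamma/\!/\beta}.$$
   Context: Composition poset. A composition is a finite (possibly empty) sequence of positive integers; its diagram has $\alpha_i$ left-justified cells in the $i$-th row from the top. $\mathcal L_C$ is the poset of all compositions with cover relations: $\gamma$ covers $\beta$ if $\gamma$ is obtained from $\beta$ either by prepending a new part equal to 1 (a new top row), or by adding 1 to the first (leftmost, i.e. topmost) part of $\beta$ of size $k$ for some $k$. Diagrams of $\beta\le_C\gamma$ are aligned at the lower left. So $[\gamma,\beta]$ is an interval of $P$ exactly when $\beta\le_C\gamma$ in $\mathcal L_C$. Descent Pieri operator. Let $P$ be a graded poset whose covers are labeled by elements of a totally ordered set. For $k\ge1$, the descent Pieri operator $\overline h_k$ is the linear operator on $\mathbb ZP$ (acting on the right) given by $x.\overline h_k=\sum_\omega end(\omega)$, the sum over all saturated chains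 $\omega: x\xrightarrow{b_1}x_1\xrightarrow{b_2}\cdots\xrightarrow{b_k}x_k=end(\omega)$ with $b_1\le b_2\le\cdots\le b_k$. Identify $\overline h_k$ with the generator $\mathbf h_k$ (complete noncommutative symmetric function) of $NSym$, the graded dual of $QSym$; thus each $a\in NSym$ acts as an operator $\overline a$, and in particular $\mathbf h_\alpha=\mathbf h_{\alpha_1}\cdots\mathbf h_{\alpha_r}$, the basis element dual to the monomial quasisymmetric function $M_\alpha$, acts as $x\mapsto x.\overline h_{\alpha_1}.\overline h_{\alpha_2}\cdots.\overline h_{\alpha_r}$. For an interval $[x,y]$ of $P$, $$K_{[x,y]}=\sum_\alpha\langle x.\overline a_\alpha,y\rangle\, b_\alpha\in QSym,$$ where $\{a_\alpha\}$ is any graded basis of $NSym$, $\{b_\alpha\}$ the dual basis of $QSym$, and $\langle\cdot,\cdot\rangle$ the bilinear form on $\mathbb ZP$ with $\langle u,v\rangle=\delta_{u,v}$ for $u,v\in P$ (e.g. $K_{[x,y]}=\sum_\alpha\langle x.\overline h_{\alpha_1}\cdots\overline h_{\alpha_r},y\rangle M_\alpha$). Skew quasisymmetric Schur functions. With cells indexed (row from top, column), a semistandard composition tableau (SSCT) of shape $\alpha$ is a filling $T$ of the diagram of $\alpha$ by positive integers with rows weakly decreasing left to right, first column strictly increasing top to bottom, and such that if $i<j$, $(i,k)$ and $(j,k+1)$ are cells of $\alpha$ and $T(j,k+1)\le T(i,k)$, then $(i,k+1)$ is a cell of $\alpha$ and $T(j,k+1)<T(i,k+1)$. The quasisymmetric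 Schur functions $\mathcal S_\alpha=\sum_T\prod_cx_{T(c)}$ (over SSCT of shape $\alpha$) form a basis of $QSym$, whose coproduct is $\Delta M_\alpha=\sum_{\beta\gamma=\alpha}M_\beta\otimes M_\gamma$ (concatenation). The skew quasisymmetric Schur functions are defined by $\Delta\mathcal S_\gamma=\sum_\beta\mathcal S_{\gamma/\!/\beta}\otimes\mathcal S_\beta$, $\beta$ over all compositions. *)

theory Defs
  imports Main "HOL-Library.Poly_Mapping"
begin

section \<open>Compositions and the composition poset\<close>

definition compositions :: "nat list set" where
  "compositions = {\<alpha>. 0 \<notin> set \<alpha>}"

(* cells are (row from the top, column), both counted from 1 *)
definition diagram :: "nat list \<Rightarrow> (nat \<times> nat) set" where
  "diagram \<alpha> = {(i, k). 1 \<le> i \<and> i \<le> length \<alpha> \<and> 1 \<le> k \<and> k \<le> \<alpha> ! (i - 1)}"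

(* the same cells as (column, row from the bottom); in these coordinates diagrams are
   aligned at the lower left *)
definition cartesian_diagram :: "nat list \<Rightarrow> (nat \<times> nat) set" where
  "cartesian_diagram \<alpha> = (\<lambda>(i, k). (k, length \<alpha> + 1 - i)) ` diagram \<alpha>"

definition covers_C :: "nat list \<Rightarrow> nat list \<Rightarrow> bool" where
  "covers_C \<gamma> \<beta> \<longleftrightarrow> \<beta> \<in> compositions \<and>
     (\<gamma> = 1 # \<beta> \<or>
      (\<exists>i k. i < length \<beta> \<and> \<beta> ! i = k \<and> (\<forall>j<i. \<beta> ! j \<noteq> k) \<and> \<gamma> = \<beta>[i := k + 1]))"

definition le_C :: "nat list \<Rightarrow> nat list \<Rightarrow> bool" where
  "le_C \<beta> \<gamma> \<longleftrightarrow> \<beta> \<in> compositions \<and> \<gamma> \<in> compositions \<and> (\<lambda>\<beta> \<gamma>. covers_C \<gamma> \<beta>)\<^sup>*\<^sup>* \<beta> \<gamma>"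


section \<open>Quasisymmetric functions\<close>

(* An exponent vector m stands for the monomial \<Prod>i\<ge>1. x_i ^ (lookup m i), and a power series is
   its coefficient function.  The variables are x_1, x_2, ...; there is no x_0. *)
type_synonym monomial = "nat \<Rightarrow>\<^sub>0 nat"
type_synonym series = "monomial \<Rightarrow> int"

definition power_product :: "nat list \<Rightarrow> nat list \<Rightarrow> monomial" where
  "power_product is \<alpha> = (\<Sum>j<length \<alpha>. Poly_Mapping.single (is ! j) (\<alpha> ! j))"

definition index_lists :: "nat \<Rightarrow> nat list set" where
  "index_lists r = {is. length is = r \<and> 0 \<notin> set is \<and> sorted_wrt (<) is}"

definition degree :: "monomial \<Rightarrow> nat" where
  "degree m = (\<Sum>i\<in>Poly_Mapping.keys m. Poly_Mapping.lookup m i)"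

definition QSym :: "series set" where
  "QSym = {f.
     (\<forall>m. 0 \<in> Poly_Mapping.keys m \<longrightarrow> f m = 0) \<and>
     (\<exists>d. \<forall>m. f m \<noteq> 0 \<longrightarrow> degree m \<le> d) \<and>
     (\<forall>\<alpha>\<in>compositions. \<forall>is\<in>index_lists (length \<alpha>). \<forall>js\<in>index_lists (length \<alpha>).
        f (power_product is \<alpha>) = f (power_product js \<alpha>))}"

(* M_\<alpha> = \<Sum> x_(i_1)^\<alpha>_1 ... x_(i_r)^\<alpha>_r over i_1 < ... < i_r *)
definition monomial_qsym :: "nat list \<Rightarrow> series" where
  "monomial_qsym \<alpha> = (\<lambda>m. int (card {is \<in> index_lists (length \<alpha>). power_product is \<alpha> = m}))"

(* the coefficient of M_\<alpha> in f, which for f in QSym is the coefficient of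
   x_1^\<alpha>_1 ... x_r^\<alpha>_r *)
definition monomial_coeff :: "series \<Rightarrow> nat list \<Rightarrow> int" where
  "monomial_coeff f \<alpha> = f (power_product [1..<length \<alpha> + 1] \<alpha>)"

(* QSym \<otimes> QSym is realised inside the power series in two sets of variables, with f \<otimes> g the
   product f(x) g(y); this is faithful because QSym is free over the integers. *)
definition tensor :: "series \<Rightarrow> series \<Rightarrow> monomial \<times> monomial \<Rightarrow> int" where
  "tensor f g = (\<lambda>(m, n). f m * g n)"

(* the linear map with \<Delta> M_\<alpha> = \<Sum> M_\<beta> \<otimes> M_\<gamma> over all factorisations \<beta>\<gamma> = \<alpha> *)
definition coproduct :: "series \<Rightarrow> monomial \<times> monomial \<Rightarrow> int" where
  "coproduct f = (\<lambda>mn. \<Sum>\<alpha> | \<alpha> \<in> compositions \<and> monomial_coeff f \<alpha> \<noteq> 0.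
     monomial_coeff f \<alpha> *
       (\<Sum>(\<beta>, \<gamma>) | \<beta> @ \<gamma> = \<alpha>. tensor (monomial_qsym \<beta>) (monomial_qsym \<gamma>) mn))"


section \<open>Quasisymmetric Schur functions and their skew versions\<close>

(* fillings are 0 outside the diagram, so that distinct T are distinct tableaux *)
definition SSCT :: "nat list \<Rightarrow> (nat \<times> nat \<Rightarrow> nat) set" where
  "SSCT \<alpha> = {T.
     (\<forall>c. c \<in> diagram \<alpha> \<longrightarrow> T c > 0) \<and>
     (\<forall>c. c \<notin> diagram \<alpha> \<longrightarrow> T c = 0) \<and>
     (\<forall>i k. (i, k) \<in> diagram \<alpha> \<and> (i, k + 1) \<in> diagram \<alpha> \<longrightarrow> T (i, k) \<ge> T (i, k + 1)) \<and>
     (\<forall>i j. (i, 1) \<in> diagram \<alpha> \<and> (j, 1) \<in> diagram \<alpha> \<and> i < j \<longrightarrow> T (i, 1) < T (j, 1)) \<and>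
     (\<forall>i j k. i < j \<and> (i, k) \<in> diagram \<alpha> \<and> (j, k + 1) \<in> diagram \<alpha> \<and> T (j, k + 1) \<le> T (i, k)
        \<longrightarrow> (i, k + 1) \<in> diagram \<alpha> \<and> T (j, k + 1) < T (i, k + 1))}"

definition qsym_schur :: "nat list \<Rightarrow> series" where
  "qsym_schur \<alpha> =
     (\<lambda>m. int (card {T \<in> SSCT \<alpha>. (\<Sum>c\<in>diagram \<alpha>. Poly_Mapping.single (T c) 1) = m}))"

(* F \<beta> plays the role of S_{\<gamma>//\<beta>}; outside the compositions F is fixed to 0, so that the family
   is determined by \<gamma> *)
definition is_skew_family :: "nat list \<Rightarrow> (nat list \<Rightarrow> series) \<Rightarrow> bool" where
  "is_skew_family \<gamma> F \<longleftrightarrow>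
     (\<forall>\<beta>\<in>compositions. F \<beta> \<in> QSym) \<and>
     (\<forall>\<beta>. \<beta> \<notin> compositions \<longrightarrow> F \<beta> = (\<lambda>_. 0)) \<and>
     finite {\<beta>. F \<beta> \<noteq> (\<lambda>_. 0)} \<and>
     coproduct (qsym_schur \<gamma>) =
       (\<lambda>mn. \<Sum>\<beta> | \<beta> \<in> compositions \<and> F \<beta> \<noteq> (\<lambda>_. 0). tensor (F \<beta>) (qsym_schur \<beta>) mn)"

definition skew_qsym_schur :: "nat list \<Rightarrow> nat list \<Rightarrow> series" where
  "skew_qsym_schur \<gamma> \<beta> = (THE F. is_skew_family \<gamma> F) \<beta>"


section \<open>The descent Pieri operators of an edge-labelled poset\<close>

(* E x b y means that y covers x and that this cover is labelled b; le is the order of the labels.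
   A saturated chain starting at x is the list of its steps (b_1, x_1), ..., (b_k, x_k). *)

fun saturated_chain :: "('p \<Rightarrow> 'l \<Rightarrow> 'p \<Rightarrow> bool) \<Rightarrow> 'p \<Rightarrow> ('l \<times> 'p) list \<Rightarrow> bool" where
  "saturated_chain E x [] \<longleftrightarrow> True"
| "saturated_chain E x ((b, y) # \<omega>) \<longleftrightarrow> E x b y \<and> saturated_chain E y \<omega>"

definition chain_end :: "'p \<Rightarrow> ('l \<times> 'p) list \<Rightarrow> 'p" where
  "chain_end x \<omega> = last (x # map snd \<omega>)"

definition descent_chains ::
  "('p \<Rightarrow> 'l \<Rightarrow> 'p \<Rightarrow> bool) \<Rightarrow> ('l \<Rightarrow> 'l \<Rightarrow> bool) \<Rightarrow> nat \<Rightarrow> 'p \<Rightarrow> ('l \<times> 'p) list set" where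
  "descent_chains E le k x =
     {\<omega>. length \<omega> = k \<and> saturated_chain E x \<omega> \<and> sorted_wrt le (map fst \<omega>)}"

(* the free abelian group on P is the type of finitely supported functions from P to the integers *)
definition descent_pieri ::
  "('p \<Rightarrow> 'l \<Rightarrow> 'p \<Rightarrow> bool) \<Rightarrow> ('l \<Rightarrow> 'l \<Rightarrow> bool) \<Rightarrow> nat \<Rightarrow> ('p \<Rightarrow>\<^sub>0 int) \<Rightarrow> ('p \<Rightarrow>\<^sub>0 int)" where
  "descent_pieri E le k u =
     (\<Sum>x\<in>Poly_Mapping.keys u. \<Sum>\<omega>\<in>descent_chains E le k x.
        Poly_Mapping.single (chain_end x \<omega>) (Poly_Mapping.lookup u x))"

(* the action of h_\<alpha>; operators act on the right, so the one for the first part comes first *)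
definition descent_pieri_comp ::
  "('p \<Rightarrow> 'l \<Rightarrow> 'p \<Rightarrow> bool) \<Rightarrow> ('l \<Rightarrow> 'l \<Rightarrow> bool) \<Rightarrow> nat list \<Rightarrow> ('p \<Rightarrow>\<^sub>0 int) \<Rightarrow> ('p \<Rightarrow>\<^sub>0 int)" where
  "descent_pieri_comp E le \<alpha> u = fold (descent_pieri E le) \<alpha> u"

definition pairing :: "('p \<Rightarrow>\<^sub>0 int) \<Rightarrow> ('p \<Rightarrow>\<^sub>0 int) \<Rightarrow> int" where
  "pairing u v = (\<Sum>x\<in>Poly_Mapping.keys u. Poly_Mapping.lookup u x * Poly_Mapping.lookup v x)"

(* K_{[x,y]}, expanded in the dual bases h_\<alpha> of NSym and M_\<alpha> of QSym; any other pair of dual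
   graded bases gives the same function *)
definition K_interval ::
  "('p \<Rightarrow> 'l \<Rightarrow> 'p \<Rightarrow> bool) \<Rightarrow> ('l \<Rightarrow> 'l \<Rightarrow> bool) \<Rightarrow> 'p \<Rightarrow> 'p \<Rightarrow> series" where
  "K_interval E le x y = (\<lambda>m.
     let c = (\<lambda>\<alpha>. pairing (descent_pieri_comp E le \<alpha> (Poly_Mapping.single x 1))
                         (Poly_Mapping.single y 1))
     in \<Sum>\<alpha> | \<alpha> \<in> compositions \<and> c \<alpha> \<noteq> 0. c \<alpha> * monomial_qsym \<alpha> m)"


section \<open>The labelled dual composition poset\<close>

definition covers_dual_C :: "nat list \<Rightarrow> nat list \<Rightarrow> bool" where
  "covers_dual_C \<beta> \<gamma> \<longleftrightarrow> covers_C \<gamma> \<beta>"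

definition le_dual_C :: "nat list \<Rightarrow> nat list \<Rightarrow> bool" where
  "le_dual_C \<gamma> \<beta> \<longleftrightarrow> le_C \<beta> \<gamma>"

definition edge_dual_C :: "nat list \<Rightarrow> int \<times> int \<Rightarrow> nat list \<Rightarrow> bool" where
  "edge_dual_C x b y \<longleftrightarrow> covers_dual_C y x \<and>
     (\<exists>i j. cartesian_diagram x - cartesian_diagram y = {(i, j)} \<and> b = (- int i, - int j))"

fun label_less :: "int \<times> int \<Rightarrow> int \<times> int \<Rightarrow> bool" where
  "label_less (i, j) (k, l) \<longleftrightarrow>
     i < k \<or> (i = k \<and> k = -1 \<and> j > l) \<or> (i = k \<and> k < -1 \<and> j < l)"

definition label_le :: "int \<times> int \<Rightarrow> int \<times> int \<Rightarrow> bool" where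
  "label_le a b \<longleftrightarrow> label_less a b \<or> a = b"

end

theory Submission
  imports Defs "HOL.Modules"
begin

text \<open>
  A chain of the dual composition poset deletes cells one at a time, and its labels are weakly
  increasing exactly when the columns of the deleted cells strictly decrease: the tie-breaking in
  the order of the labels is opposite to the only order in which two cells of one column can be
  deleted in succession (\<open>same_column_not_label_le\<close>).

  The same deletions take an SSCT apart.  The cells that hold its smallest entry lie in distinct
  columns; the rightmost of them can be deleted along an edge of the poset, and what remains is an
  SSCT.  Conversely a new smallest entry may be put into a cell added along an edge, provided its
  column is to the right of all equal entries (\<open>bij_betw_min_tableaux\<close>).  Peeling off one value after
  the other shows that the coefficient of \<open>x_(i_1)^\<alpha>_1 ... x_(i_r)^\<alpha>_r\<close> in \<open>S_\<gamma>\<close> is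
  \<open>\<langle>\<gamma>.h_\<alpha>, \<emptyset>\<rangle>\<close>, that is, \<open>S_\<gamma> = K_[\<gamma>,\<emptyset>]\<close> (\<open>qsym_schur_power_product\<close>).

  The operator of a concatenation \<open>\<alpha>\<beta>\<close> is the operator of \<open>\<alpha>\<close> followed by that of \<open>\<beta>\<close>, while the
  coproduct cuts \<open>M_\<alpha>\<close> into the two factors of every factorisation.  Inserting a sum over the
  intermediate element \<open>\<beta>\<close> therefore gives \<open>\<Delta> S_\<gamma> = \<Sum> K_[\<gamma>,\<beta>] \<otimes> S_\<beta>\<close> (\<open>coproduct_qsym_schur_K\<close>).

  This identifies the skew functions once the \<open>S_\<beta>\<close> are known to be linearly independent.  They are
  unitriangular with respect to the monomial basis: a tableau of shape \<open>\<alpha>\<close> and content \<open>\<beta>\<close> forces \<open>\<alpha>\<close>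
  to be at most \<open>\<beta>\<close> in the length-lexicographic order, and for \<open>\<alpha> = \<beta>\<close> the only such tableau has every
  entry equal to its row index (\<open>SSCT_leading_content\<close>).
\<close>

section \<open>Exponent sequences of monomials\<close>

text \<open>The exponents are listed by increasing variable, so a monomial without \<open>x_0\<close> occurs in
  \<open>M_\<alpha>\<close> for exactly one composition \<open>\<alpha>\<close>, namely this one.\<close>

definition exponents :: "monomial \<Rightarrow> nat list" where
  "exponents m = map (Poly_Mapping.lookup m) (sorted_list_of_set (Poly_Mapping.keys m))"

lemma exponents_in_compositions: "exponents m \<in> compositions"
  by (auto simp: exponents_def compositions_def in_keys_iff)

lemma degree_eq_sum_exponents: "degree m = sum_list (exponents m)"
  by (simp add: degree_def exponents_def sum_list_distinct_conv_sum_set)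

lemma lookup_power_product_nth:
  assumes "distinct is" "length is = length \<alpha>" "j < length \<alpha>"
  shows "Poly_Mapping.lookup (power_product is \<alpha>) (is ! j) = \<alpha> ! j"
proof -
  have "Poly_Mapping.lookup (power_product is \<alpha>) (is ! j)
      = (\<Sum>i<length \<alpha>. if i = j then \<alpha> ! i else 0)"
    unfolding power_product_def lookup_sum
    by (rule sum.cong) (use assms in \<open>auto simp: lookup_single when_def nth_eq_iff_index_eq\<close>)
  then show ?thesis using assms by simp
qed

lemma lookup_power_product_notin:
  assumes "length is = length \<alpha>" "i \<notin> set is"
  shows "Poly_Mapping.lookup (power_product is \<alpha>) i = 0"
  using assms unfolding power_product_def lookup_sum
  by (auto simp: lookup_single when_def)

lemma keys_power_product:
  assumes "is \<in> index_lists (length \<alpha>)" "\<alpha> \<in> compositions"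
  shows "Poly_Mapping.keys (power_product is \<alpha>) = set is"
proof -
  have "distinct is" "length is = length \<alpha>"
    using assms by (auto simp: index_lists_def strict_sorted_iff)
  note d = this
  show ?thesis
  proof (intro subset_antisym subsetI)
    fix i assume "i \<in> Poly_Mapping.keys (power_product is \<alpha>)"
    then show "i \<in> set is"
      using lookup_power_product_notin[OF d(2)] by (metis in_keys_iff)
  next
    fix i assume "i \<in> set is"
    then obtain j where j: "j < length \<alpha>" "i = is ! j"
      using d(2) by (metis in_set_conv_nth)
    then have "\<alpha> ! j \<noteq> 0"
      using assms(2) nth_mem[OF j(1)] by (metis compositions_def mem_Collect_eq)
    then show "i \<in> Poly_Mapping.keys (power_product is \<alpha>)"
      using lookup_power_product_nth[OF d j(1)] j(2) by (simp add: in_keys_iff)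
  qed
qed

lemma sorted_keys_power_product:
  assumes "is \<in> index_lists (length \<alpha>)" "\<alpha> \<in> compositions"
  shows "sorted_list_of_set (Poly_Mapping.keys (power_product is \<alpha>)) = is"
  using assms by (simp add: keys_power_product index_lists_def strict_sorted_iff
      sorted_list_of_set.idem_if_sorted_distinct)

lemma exponents_power_product:
  assumes "is \<in> index_lists (length \<alpha>)" "\<alpha> \<in> compositions"
  shows "exponents (power_product is \<alpha>) = \<alpha>"
proof -
  have "distinct is" "length is = length \<alpha>"
    using assms by (auto simp: index_lists_def strict_sorted_iff)
  then show ?thesis
    using assms by (auto simp: exponents_def sorted_keys_power_product
        lookup_power_product_nth intro!: nth_equalityI)
qed

lemma sorted_keys_in_index_lists:
  "0 \<notin> Poly_Mapping.keys m \<Longrightarrow>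
   sorted_list_of_set (Poly_Mapping.keys m) \<in> index_lists (length (exponents m))"
  by (simp add: index_lists_def exponents_def)

lemma power_product_exponents:
  "power_product (sorted_list_of_set (Poly_Mapping.keys m)) (exponents m) = m" (is "?p = m")
proof (rule poly_mapping_eqI)
  fix i
  let ?is = "sorted_list_of_set (Poly_Mapping.keys m)"
  show "Poly_Mapping.lookup ?p i = Poly_Mapping.lookup m i"
  proof (cases "i \<in> Poly_Mapping.keys m")
    case True
    then obtain j where "j < length ?is" "?is ! j = i"
      by (metis in_set_conv_nth finite_keys set_sorted_list_of_set)
    then show ?thesis
      using lookup_power_product_nth[of ?is "exponents m" j]
      by (simp add: exponents_def)
  next
    case False
    then show ?thesis
      using lookup_power_product_notin[of ?is "exponents m" i]
      by (simp add: exponents_def in_keys_iff)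
  qed
qed

text \<open>Distinct \<open>M_\<alpha>\<close> share no monomial: a series expanded in this basis has, at a monomial, the one
  coefficient indexed by its exponent sequence.\<close>

lemma monomial_qsym_eq:
  assumes "\<alpha> \<in> compositions"
  shows "monomial_qsym \<alpha> m = (if 0 \<notin> Poly_Mapping.keys m \<and> exponents m = \<alpha> then 1 else 0)"
proof (cases "0 \<notin> Poly_Mapping.keys m \<and> exponents m = \<alpha>")
  case True
  define s where "s = sorted_list_of_set (Poly_Mapping.keys m)"
  have "s \<in> index_lists (length \<alpha>)"
    using True sorted_keys_in_index_lists[of m] by (simp add: s_def)
  moreover have "power_product s \<alpha> = m"
    using True power_product_exponents[of m] by (simp add: s_def)
  moreover have "is = s" if "is \<in> index_lists (length \<alpha>)" "power_product is \<alpha> = m" for "is"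
    using sorted_keys_power_product[OF that(1) assms] unfolding that(2) s_def by (rule sym)
  ultimately have "{is \<in> index_lists (length \<alpha>). power_product is \<alpha> = m} = {s}"
    by blast
  then show ?thesis using True by (simp add: monomial_qsym_def)
next
  case False
  have "0 \<notin> Poly_Mapping.keys m \<and> exponents m = \<alpha>"
    if "is \<in> index_lists (length \<alpha>)" "power_product is \<alpha> = m" for "is"
    using keys_power_product[OF that(1) assms] exponents_power_product[OF that(1) assms] that(1)
    unfolding that(2) by (simp add: index_lists_def)
  then have "{is \<in> index_lists (length \<alpha>). power_product is \<alpha> = m} = {}"
    using False by blast
  then show ?thesis unfolding monomial_qsym_def if_not_P[OF False] by (metis card.empty of_nat_0)
qed

lemma finite_compositions_sum_le: "finite {\<alpha> \<in> compositions. sum_list \<alpha> \<le> n}"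
proof (rule finite_subset)
  show "{\<alpha> \<in> compositions. sum_list \<alpha> \<le> n} \<subseteq> {\<alpha>. set \<alpha> \<subseteq> {..n} \<and> length \<alpha> \<le> n}"
  proof (rule subsetI)
    fix \<alpha> assume a: "\<alpha> \<in> {\<alpha> \<in> compositions. sum_list \<alpha> \<le> n}"
    then have "\<forall>x\<in>set \<alpha>. 1 \<le> x"
      by (auto simp: compositions_def Suc_le_eq intro!: gr0I)
    then have "sum_list (map (\<lambda>_. 1) \<alpha>) \<le> sum_list (map (\<lambda>x. x) \<alpha>)"
      by (intro sum_list_mono) simp
    then have "length \<alpha> \<le> n" using a by (simp add: sum_list_triv)
    moreover have "set \<alpha> \<subseteq> {..n}"
      using a member_le_sum_list[of _ \<alpha>] by fastforce
    ultimately show "\<alpha> \<in> {\<alpha>. set \<alpha> \<subseteq> {..n} \<and> length \<alpha> \<le> n}" by simp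
  qed
qed (simp add: finite_lists_length_le)

lemma lookup_sum_single:
  assumes "finite A"
  shows "Poly_Mapping.lookup (\<Sum>c\<in>A. Poly_Mapping.single (f c) (1::nat)) v = card {c \<in> A. f c = v}"
proof -
  have "Poly_Mapping.lookup (\<Sum>c\<in>A. Poly_Mapping.single (f c) (1::nat)) v =
      (\<Sum>c\<in>A. if f c = v then 1 else 0)"
    unfolding lookup_sum by (rule sum.cong) (auto simp: lookup_single when_def)
  then show ?thesis using assms by (simp add: sum.If_cases Collect_conj_eq)
qed

section \<open>Matrix entries of the Pieri operators\<close>

text \<open>Additivity needs one range of summation for both arguments, which their supports do not provide.\<close>

lemma descent_pieri_superset:
  assumes "finite A" "Poly_Mapping.keys u \<subseteq> A"
  shows "descent_pieri E le k u = (\<Sum>x\<in>A. \<Sum>\<omega>\<in>descent_chains E le k x.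
           Poly_Mapping.single (chain_end x \<omega>) (Poly_Mapping.lookup u x))"
  unfolding descent_pieri_def
  by (rule sum.mono_neutral_left) (use assms in \<open>auto simp: in_keys_iff\<close>)

lemma descent_pieri_add:
  "descent_pieri E le k (u + v) = descent_pieri E le k u + descent_pieri E le k v"
  using Poly_Mapping.keys_add[of u v]
  by (simp add: descent_pieri_superset[of "Poly_Mapping.keys u \<union> Poly_Mapping.keys v"]
      lookup_add single_add sum.distrib)

lemma additive_descent_pieri_comp: "Modules.additive (descent_pieri_comp E le \<alpha>)"
proof (induction \<alpha>)
  case (Cons k \<alpha>)
  then show ?case
    by (simp add: Modules.additive_def descent_pieri_comp_def descent_pieri_add)
qed (simp add: Modules.additive_def descent_pieri_comp_def)

text \<open>The matrix entry \<open>\<langle>x.h_\<alpha>, y\<rangle>\<close>.  In a poset with finitely many edges out of every element it is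
  the number of chains from \<open>x\<close> to \<open>y\<close> that split into weakly increasing pieces of lengths
  \<open>\<alpha>_1, \<alpha>_2, ...\<close>.\<close>

definition chain_count :: "('p \<Rightarrow> 'l \<Rightarrow> 'p \<Rightarrow> bool) \<Rightarrow> ('l \<Rightarrow> 'l \<Rightarrow> bool) \<Rightarrow> nat list \<Rightarrow> 'p \<Rightarrow> 'p \<Rightarrow> int" where
  "chain_count E le \<alpha> x y =
     Poly_Mapping.lookup (descent_pieri_comp E le \<alpha> (Poly_Mapping.single x 1)) y"

lemma chain_count_Nil: "chain_count E le [] x y = (if x = y then 1 else 0)"
  by (simp add: chain_count_def descent_pieri_comp_def lookup_single when_def)

lemma chain_count_Cons:
  "chain_count E le (k # \<alpha>) x y = (\<Sum>\<omega>\<in>descent_chains E le k x. chain_count E le \<alpha> (chain_end x \<omega>) y)"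
proof -
  have "descent_pieri_comp E le (k # \<alpha>) (Poly_Mapping.single x 1)
     = descent_pieri_comp E le \<alpha> (\<Sum>\<omega>\<in>descent_chains E le k x. Poly_Mapping.single (chain_end x \<omega>) 1)"
    by (simp add: descent_pieri_comp_def descent_pieri_def)
  then show ?thesis
    by (simp add: chain_count_def Modules.additive.sum[OF additive_descent_pieri_comp] lookup_sum)
qed

text \<open>An additive map between free abelian groups commutes with integer multiples.\<close>

lemma lookup_descent_pieri_comp_single:
  "Poly_Mapping.lookup (descent_pieri_comp E le \<alpha> (Poly_Mapping.single x n)) y = n * chain_count E le \<alpha> x y"
proof (induction n rule: int_induct[where k = 0])
  case base
  show ?case by (simp add: Modules.additive.zero[OF additive_descent_pieri_comp])
next
  case (step1 i)
  then show ?case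
    by (simp add: single_add Modules.additive.add[OF additive_descent_pieri_comp] lookup_add
        chain_count_def algebra_simps)
next
  case (step2 i)
  then show ?case
    by (simp add: single_diff Modules.additive.diff[OF additive_descent_pieri_comp] lookup_minus
        chain_count_def algebra_simps)
qed

text \<open>Operators are composed by multiplying their matrices; \<open>Z\<close> only has to contain the elements that
  can occur in the middle.\<close>

lemma chain_count_append:
  assumes "finite Z" "\<And>z. chain_count E le \<alpha> x z \<noteq> 0 \<Longrightarrow> z \<in> Z"
  shows "chain_count E le (\<alpha> @ \<beta>) x y = (\<Sum>z\<in>Z. chain_count E le \<alpha> x z * chain_count E le \<beta> z y)"
proof -
  let ?u = "descent_pieri_comp E le \<alpha> (Poly_Mapping.single x 1)"
  have u: "?u = (\<Sum>z\<in>Z. Poly_Mapping.single z (chain_count E le \<alpha> x z))"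
  proof (rule poly_mapping_eqI)
    fix w
    have "Poly_Mapping.lookup (\<Sum>z\<in>Z. Poly_Mapping.single z (chain_count E le \<alpha> x z)) w
        = (\<Sum>z\<in>Z. if z = w then chain_count E le \<alpha> x w else 0)"
      unfolding lookup_sum by (rule sum.cong) (auto simp: lookup_single when_def)
    also have "\<dots> = chain_count E le \<alpha> x w"
      using assms by auto
    finally show "Poly_Mapping.lookup ?u w
        = Poly_Mapping.lookup (\<Sum>z\<in>Z. Poly_Mapping.single z (chain_count E le \<alpha> x z)) w"
      by (simp add: chain_count_def)
  qed
  have "chain_count E le (\<alpha> @ \<beta>) x y = Poly_Mapping.lookup (descent_pieri_comp E le \<beta> ?u) y"
    by (simp add: chain_count_def descent_pieri_comp_def)
  then show ?thesis
    unfolding u by (simp add: Modules.additive.sum[OF additive_descent_pieri_comp] lookup_sum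
        lookup_descent_pieri_comp_single)
qed

lemma pairing_single: "pairing u (Poly_Mapping.single y 1) = Poly_Mapping.lookup u y"
proof -
  have "pairing u (Poly_Mapping.single y 1)
      = (\<Sum>x\<in>Poly_Mapping.keys u. if x = y then Poly_Mapping.lookup u x else 0)"
    unfolding pairing_def by (rule sum.cong) (auto simp: lookup_single when_def)
  then show ?thesis by (simp add: in_keys_iff)
qed

lemma K_interval_eq:
  assumes "finite {\<alpha> \<in> compositions. chain_count E le \<alpha> x y \<noteq> 0}"
  shows "K_interval E le x y m =
    (if 0 \<in> Poly_Mapping.keys m then 0 else chain_count E le (exponents m) x y)"
proof -
  have "K_interval E le x y m = (\<Sum>\<alpha> | \<alpha> \<in> compositions \<and> chain_count E le \<alpha> x y \<noteq> 0.
      if exponents m = \<alpha> then (if 0 \<in> Poly_Mapping.keys m then 0 else chain_count E le \<alpha> x y) else 0)"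
    unfolding K_interval_def Let_def pairing_single chain_count_def[symmetric]
    by (rule sum.cong) (auto simp: monomial_qsym_eq)
  then show ?thesis using assms by (simp add: exponents_in_compositions)
qed

section \<open>Removable cells\<close>

text \<open>Rows are numbered from the bottom, starting with 1, and have length 0 outside the diagram.  In
  these coordinates an edge of the poset changes a single value of the function, even when the top row
  disappears; with rows numbered from the top all the others would be renumbered.\<close>

definition row :: "nat list \<Rightarrow> nat \<Rightarrow> nat" where
  "row \<alpha> j = (if 1 \<le> j \<and> j \<le> length \<alpha> then \<alpha> ! (length \<alpha> - j) else 0)"

lemma cartesian_diagram_iff: "(k, j) \<in> cartesian_diagram \<alpha> \<longleftrightarrow> 1 \<le> k \<and> k \<le> row \<alpha> j"
proof
  assume "(k, j) \<in> cartesian_diagram \<alpha>"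
  then obtain i where "1 \<le> i" "i \<le> length \<alpha>" "1 \<le> k" "k \<le> \<alpha> ! (i - 1)" "j = length \<alpha> + 1 - i"
    by (auto simp: cartesian_diagram_def diagram_def)
  moreover from this have "length \<alpha> - j = i - 1" by simp
  ultimately show "1 \<le> k \<and> k \<le> row \<alpha> j" by (simp add: row_def) linarith
next
  assume a: "1 \<le> k \<and> k \<le> row \<alpha> j"
  then have j: "1 \<le> j" "j \<le> length \<alpha>" by (auto simp: row_def split: if_splits)
  with a have "(length \<alpha> + 1 - j, k) \<in> diagram \<alpha>"
    by (auto simp: diagram_def row_def)
  then have "(\<lambda>(i, k). (k, length \<alpha> + 1 - i)) (length \<alpha> + 1 - j, k) \<in> cartesian_diagram \<alpha>"
    unfolding cartesian_diagram_def by (rule imageI)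
  then show "(k, j) \<in> cartesian_diagram \<alpha>" using j by simp
qed

lemma row_pos_iff:
  assumes "\<alpha> \<in> compositions"
  shows "0 < row \<alpha> j \<longleftrightarrow> 1 \<le> j \<and> j \<le> length \<alpha>"
proof -
  have "0 < \<alpha> ! (length \<alpha> - j)" if "1 \<le> j" "j \<le> length \<alpha>"
    using that assms nth_mem[of "length \<alpha> - j" \<alpha>]
    by (metis compositions_def mem_Collect_eq gr0I diff_less less_le_trans less_numeral_extra(1))
  then show ?thesis by (auto simp: row_def)
qed

lemma row_length_diff: "i < length \<alpha> \<Longrightarrow> row \<alpha> (length \<alpha> - i) = \<alpha> ! i"
  by (auto simp: row_def)

lemma row_eqD:
  assumes "row \<alpha> = row \<beta>" "\<alpha> \<in> compositions" "\<beta> \<in> compositions"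
  shows "\<alpha> = \<beta>"
proof -
  have le: "length \<alpha> \<le> length \<beta>"
    if "row \<alpha> = row \<beta>" "\<alpha> \<in> compositions" "\<beta> \<in> compositions" for \<alpha> \<beta>
    using row_pos_iff[OF that(2), of "length \<alpha>"] row_pos_iff[OF that(3), of "length \<alpha>"] that(1)
    by (cases "length \<alpha> = 0") auto
  have len: "length \<alpha> = length \<beta>"
    using le[of \<alpha> \<beta>] le[of \<beta> \<alpha>] assms by simp
  show ?thesis
  proof (rule nth_equalityI[OF len])
    fix i assume i: "i < length \<alpha>"
    show "\<alpha> ! i = \<beta> ! i"
      using row_length_diff[of i \<alpha>] row_length_diff[of i \<beta>] i len assms(1) by simp
  qed
qed

lemma row_Nil: "row [] = (\<lambda>_. 0)"
  by (auto simp: row_def)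

lemma row_Cons: "row (a # \<alpha>) = (row \<alpha>)(Suc (length \<alpha>) := a)"
  by (auto simp: row_def fun_eq_iff nth_Cons' Suc_diff_le)

lemma row_list_update:
  "i < length \<alpha> \<Longrightarrow> row (\<alpha>[i := a]) = (row \<alpha>)(length \<alpha> - i := a)"
  by (auto simp: row_def fun_eq_iff nth_list_update)

lemma row_le_sum_list: "row \<alpha> j \<le> sum_list \<alpha>"
  by (auto simp: row_def intro!: member_le_sum_list)

text \<open>The cell in column \<open>k\<close> and row \<open>j\<close> can be deleted along an edge.  The rows above \<open>j\<close> must avoid
  the length \<open>k - 1\<close>, since row \<open>j\<close> has to be the topmost of that length afterwards; a row of length 1
  disappears altogether, so it must be the top row.\<close>

definition removable :: "nat list \<Rightarrow> nat \<Rightarrow> nat \<Rightarrow> bool" where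
  "removable \<gamma> k j \<longleftrightarrow> 1 \<le> k \<and> row \<gamma> j = k \<and>
     (\<forall>j'>j. if k = 1 then row \<gamma> j' = 0 else row \<gamma> j' \<noteq> k - 1)"

lemma covers_removable:
  assumes "covers_C \<gamma> \<beta>"
  obtains k j where "removable \<gamma> k j" "row \<beta> = (row \<gamma>)(j := k - 1)"
proof -
  have \<beta>: "\<beta> \<in> compositions" using assms by (simp add: covers_C_def)
  consider (new) "\<gamma> = 1 # \<beta>"
    | (grow) i where "i < length \<beta>" "\<forall>j<i. \<beta> ! j \<noteq> \<beta> ! i" "\<gamma> = \<beta>[i := \<beta> ! i + 1]"
    using assms by (auto simp: covers_C_def)
  then show thesis
  proof cases
    case new
    have "removable \<gamma> 1 (Suc (length \<beta>))" "row \<beta> = (row \<gamma>)(Suc (length \<beta>) := 1 - 1)"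
      unfolding new row_Cons by (auto simp: removable_def row_Cons row_def fun_eq_iff)
    then show thesis by (rule that)
  next
    case grow
    let ?j = "length \<beta> - i"
    have rj: "row \<beta> ?j = \<beta> ! i" using grow(1) by (rule row_length_diff)
    have r: "row \<gamma> = (row \<beta>)(?j := \<beta> ! i + 1)"
      unfolding grow(3) using grow(1) by (rule row_list_update)
    have pos: "0 < \<beta> ! i"
      using row_pos_iff[OF \<beta>, of ?j] rj grow(1) by simp
    have "row \<beta> j' \<noteq> \<beta> ! i" if "j' > ?j" for j'
    proof (cases "j' \<le> length \<beta>")
      case True
      then have "length \<beta> - j' < i" using that by simp
      then show ?thesis using grow(2) True that by (auto simp: row_def)
    qed (use pos in \<open>simp add: row_def\<close>)
    then have "removable \<gamma> (\<beta> ! i + 1) ?j" using pos by (simp add: removable_def r)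
    moreover have "row \<beta> = (row \<gamma>)(?j := \<beta> ! i + 1 - 1)" using rj r by (simp add: fun_eq_iff)
    ultimately show thesis by (rule that)
  qed
qed

lemma removable_covers:
  assumes "\<gamma> \<in> compositions" "removable \<gamma> k j"
  obtains \<beta> where "covers_C \<gamma> \<beta>" "row \<beta> = (row \<gamma>)(j := k - 1)"
proof -
  have k: "1 \<le> k" "row \<gamma> j = k" using assms(2) by (auto simp: removable_def)
  then have j: "1 \<le> j" "j \<le> length \<gamma>" using row_pos_iff[OF assms(1), of j] by auto
  show thesis
  proof (cases "k = 1")
    case True
    then have "\<not> 0 < row \<gamma> (Suc j)" using assms(2) by (simp add: removable_def)
    then have "j = length \<gamma>" using row_pos_iff[OF assms(1), of "Suc j"] j by auto
    moreover obtain a \<beta> where \<gamma>: "\<gamma> = a # \<beta>" using j by (cases \<gamma>) auto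
    moreover have "a = 1" using k(2) True \<open>j = length \<gamma>\<close> \<gamma> by (simp add: row_Cons)
    moreover have "covers_C \<gamma> \<beta>"
      using \<gamma> \<open>a = 1\<close> assms(1) by (auto simp: covers_C_def compositions_def)
    ultimately show thesis
      using that[of \<beta>] True by (simp add: row_Cons) (auto simp: row_def fun_eq_iff)
  next
    case False
    define i where "i = length \<gamma> - j"
    define \<beta> where "\<beta> = \<gamma>[i := k - 1]"
    have i: "i < length \<gamma>" "length \<gamma> - i = j" using j by (auto simp: i_def)
    have \<gamma>i: "\<gamma> ! i = k" using k j by (simp add: row_def i_def)
    have \<beta>: "\<beta> \<in> compositions"
      using assms(1) set_update_subset_insert[of \<gamma> i "k - 1"] False k(1)
      by (auto simp: compositions_def \<beta>_def)
    have above: "\<beta> ! i' \<noteq> k - 1" if "i' < i" for i'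
    proof -
      have "row \<gamma> (length \<gamma> - i') \<noteq> k - 1"
        using assms(2) that i False by (auto simp: removable_def)
      then show ?thesis using that i by (simp add: row_length_diff \<beta>_def)
    qed
    have \<gamma>: "\<gamma> = \<beta>[i := k - 1 + 1]"
      unfolding \<beta>_def using \<gamma>i k(1) list_update_id[of \<gamma> i] by simp
    have "i < length \<beta>" "\<beta> ! i = k - 1" using i(1) by (simp_all add: \<beta>_def)
    then have "covers_C \<gamma> \<beta>"
      unfolding covers_C_def using \<beta> above \<gamma> by blast
    moreover have "row \<beta> = (row \<gamma>)(j := k - 1)"
      unfolding \<beta>_def using row_list_update[OF i(1)] i(2) by simp
    ultimately show thesis by (rule that)
  qed
qed

lemma covers_in_compositions: "covers_C \<gamma> \<beta> \<Longrightarrow> \<beta> \<in> compositions"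
  by (simp add: covers_C_def)

text \<open>An edge is determined by its source and its label.\<close>

lemma edge_dual_C_iff:
  assumes "\<gamma> \<in> compositions"
  shows "edge_dual_C \<gamma> b \<beta> \<longleftrightarrow> (\<exists>k j. b = (- int k, - int j) \<and> removable \<gamma> k j \<and>
           \<beta> \<in> compositions \<and> row \<beta> = (row \<gamma>)(j := k - 1))" (is "_ \<longleftrightarrow> ?R")
proof -
  have cell: "cartesian_diagram \<gamma> - cartesian_diagram \<beta> = {(k, j)}"
    if "removable \<gamma> k j" "row \<beta> = (row \<gamma>)(j := k - 1)" for k j
    using that by (auto simp: cartesian_diagram_iff removable_def split: if_splits)
  show ?thesis
  proof
    assume e: "edge_dual_C \<gamma> b \<beta>"
    then have c: "covers_C \<gamma> \<beta>" by (simp add: edge_dual_C_def covers_dual_C_def)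
    then obtain k j where kj: "removable \<gamma> k j" "row \<beta> = (row \<gamma>)(j := k - 1)"
      by (rule covers_removable)
    moreover have "b = (- int k, - int j)"
      using e cell[OF kj] by (auto simp: edge_dual_C_def)
    ultimately show ?R using covers_in_compositions[OF c] by blast
  next
    assume ?R
    then obtain k j where kj: "b = (- int k, - int j)" "removable \<gamma> k j"
      "\<beta> \<in> compositions" "row \<beta> = (row \<gamma>)(j := k - 1)" by blast
    obtain \<beta>' where "covers_C \<gamma> \<beta>'" "row \<beta>' = (row \<gamma>)(j := k - 1)"
      using removable_covers[OF assms kj(2)] by blast
    then have "covers_C \<gamma> \<beta>"
      using row_eqD[of \<beta>' \<beta>] kj covers_in_compositions by metis
    then show "edge_dual_C \<gamma> b \<beta>"
      using cell[OF kj(2,4)] kj(1) by (auto simp: edge_dual_C_def covers_dual_C_def)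
  qed
qed

lemma edge_dual_C_sum_list:
  assumes "edge_dual_C \<gamma> b \<beta>"
  shows "sum_list \<gamma> = Suc (sum_list \<beta>)"
proof -
  have "covers_C \<gamma> \<beta>" using assms by (simp add: edge_dual_C_def covers_dual_C_def)
  then show ?thesis
    by (auto simp: covers_C_def sum_list_update)
qed

lemma edge_dual_C_in_compositions: "edge_dual_C \<gamma> b \<beta> \<Longrightarrow> \<beta> \<in> compositions"
  by (simp add: edge_dual_C_def covers_dual_C_def covers_C_def)

text \<open>After a cell of column \<open>k > 1\<close> has been deleted from row \<open>j\<close>, that row has length \<open>k - 1\<close> and blocks
  column \<open>k\<close> of all rows below it, so the next cell deleted from the same column lies above.  In the
  first column rows vanish from the top, so there it lies below.  The labels are ordered the other
  way round in both cases.\<close>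

lemma same_column_not_label_le:
  assumes "\<gamma> \<in> compositions" "edge_dual_C \<gamma> b \<beta>" "edge_dual_C \<beta> b' \<alpha>" "fst b = fst b'"
  shows "\<not> label_le b b'"
proof -
  obtain k j where e: "b = (- int k, - int j)" "removable \<gamma> k j"
      "\<beta> \<in> compositions" "row \<beta> = (row \<gamma>)(j := k - 1)"
    using assms(1,2) edge_dual_C_iff by blast
  obtain j' where e': "b' = (- int k, - int j')" "removable \<beta> k j'"
    using assms(3,4) edge_dual_C_iff[OF e(3)] e(1) by auto
  show ?thesis
  proof (cases "k = 1")
    case True
    have "j' \<noteq> j" using e e' True by (auto simp: removable_def)
    moreover have "row \<gamma> j' = 1"
      using e e' True \<open>j' \<noteq> j\<close> by (simp add: removable_def)
    moreover have "\<forall>j'>j. row \<gamma> j' = 0"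
      using e(2) True by (simp add: removable_def)
    ultimately have "j' < j" by (metis linorder_neqE_nat one_neq_zero)
    then show ?thesis using True by (auto simp: e(1) e'(1) label_le_def)
  next
    case False
    have "\<not> j' < j" using e e' False by (auto simp: removable_def)
    moreover have "j' \<noteq> j" using e e' by (auto simp: removable_def)
    ultimately show ?thesis using False e(2) by (auto simp: e(1) e'(1) label_le_def removable_def)
  qed
qed

section \<open>Descent chains\<close>

definition column :: "int \<times> int \<Rightarrow> nat" where
  "column b = nat (- fst b)"

lemma edge_column:
  assumes "\<gamma> \<in> compositions" "edge_dual_C \<gamma> b \<beta>"
  shows "fst b = - int (column b)" "column b \<le> sum_list \<gamma>"
proof -
  obtain k j where "b = (- int k, - int j)" "removable \<gamma> k j"
    using assms edge_dual_C_iff by blast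
  then show "fst b = - int (column b)" "column b \<le> sum_list \<gamma>"
    using row_le_sum_list[of \<gamma> j] by (auto simp: column_def removable_def)
qed

lemma finite_edges:
  assumes "\<gamma> \<in> compositions"
  shows "finite {(b, \<beta>). edge_dual_C \<gamma> b \<beta>}"
proof (rule finite_subset)
  let ?L = "(\<lambda>j. (- int (row \<gamma> j), - int j)) ` {..length \<gamma>}"
  let ?N = "{\<beta> \<in> compositions. sum_list \<beta> \<le> sum_list \<gamma>}"
  show "{(b, \<beta>). edge_dual_C \<gamma> b \<beta>} \<subseteq> ?L \<times> ?N"
  proof safe
    fix i j \<beta> assume e: "edge_dual_C \<gamma> (i, j) \<beta>"
    then obtain k j' where "i = - int k" "j = - int j'" "removable \<gamma> k j'"
      using assms edge_dual_C_iff by auto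
    moreover from this have "j' \<in> {..length \<gamma>}"
      by (auto simp: removable_def row_def split: if_splits)
    ultimately show "(i, j) \<in> ?L" by (auto simp: removable_def)
    show "\<beta> \<in> compositions" using e by (rule edge_dual_C_in_compositions)
    show "sum_list \<beta> \<le> sum_list \<gamma>" using edge_dual_C_sum_list[OF e] by simp
  qed
qed (simp add: finite_compositions_sum_le)

lemma chain_end_Nil [simp]: "chain_end x [] = x"
  by (simp add: chain_end_def)

lemma chain_end_Cons [simp]: "chain_end x ((b, y) # \<omega>) = chain_end y \<omega>"
  by (simp add: chain_end_def)

lemma chain_end_composition:
  assumes "\<gamma> \<in> compositions" "saturated_chain edge_dual_C \<gamma> \<omega>"
  shows "chain_end \<gamma> \<omega> \<in> compositions \<and> sum_list \<gamma> = length \<omega> + sum_list (chain_end \<gamma> \<omega>)"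
  using assms
proof (induction \<omega> arbitrary: \<gamma>)
  case (Cons s \<omega>)
  obtain b \<beta> where s: "s = (b, \<beta>)" by fastforce
  then have "edge_dual_C \<gamma> b \<beta>" using Cons.prems by simp
  then show ?case
    using Cons.IH[of \<beta>] Cons.prems s edge_dual_C_in_compositions edge_dual_C_sum_list by fastforce
qed simp

text \<open>The bound \<open>c\<close> on the columns makes the definition recursive: after a first step in column
  \<open>k < c\<close> the rest of the chain is bounded by \<open>k\<close>.\<close>

definition strips :: "nat \<Rightarrow> nat \<Rightarrow> nat list \<Rightarrow> ((int \<times> int) \<times> nat list) list set" where
  "strips a c \<gamma> = {\<omega>. length \<omega> = a \<and> saturated_chain edge_dual_C \<gamma> \<omega> \<and>
     sorted_wrt (>) (map (\<lambda>s. column (fst s)) \<omega>) \<and> (\<forall>s\<in>set \<omega>. column (fst s) < c)}"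

text \<open>Weakly increasing labels have weakly decreasing columns, and equal columns would have to occur at
  two consecutive steps, where they are excluded.\<close>

lemma sorted_labels_iff_sorted_columns:
  assumes "\<gamma> \<in> compositions" "saturated_chain edge_dual_C \<gamma> \<omega>"
  shows "sorted_wrt label_le (map fst \<omega>) \<longleftrightarrow> sorted_wrt (>) (map (\<lambda>s. column (fst s)) \<omega>)"
  using assms
proof (induction \<omega> arbitrary: \<gamma>)
  case (Cons s \<omega>)
  obtain b \<beta> where s: "s = (b, \<beta>)" by fastforce
  have e: "edge_dual_C \<gamma> b \<beta>" and sat: "saturated_chain edge_dual_C \<beta> \<omega>"
    using Cons.prems s by auto
  have \<beta>: "\<beta> \<in> compositions" using e by (rule edge_dual_C_in_compositions)
  have neg: "fst (fst t) = - int (column (fst t))" if "t \<in> set \<omega>" for t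
    using that sat \<beta>
  proof (induction \<omega> arbitrary: \<beta>)
    case (Cons u \<omega>)
    then show ?case
      by (cases u) (auto dest: edge_column(1) edge_dual_C_in_compositions)
  qed simp
  have "(\<forall>t\<in>set \<omega>. label_le b (fst t)) \<longleftrightarrow> (\<forall>t\<in>set \<omega>. column (fst t) < column b)"
    if srt: "sorted_wrt (>) (map (\<lambda>s. column (fst s)) \<omega>)"
  proof
    assume le: "\<forall>t\<in>set \<omega>. label_le b (fst t)"
    show "\<forall>t\<in>set \<omega>. column (fst t) < column b"
    proof (cases \<omega>)
      case (Cons u \<omega>')
      obtain b' \<alpha> where u: "u = (b', \<alpha>)" by fastforce
      have lb: "label_le b b'" using le Cons u by simp
      \<comment> \<open>Only the first label after \<open>b\<close> can tie with it; the later columns are smaller by \<open>srt\<close>.\<close>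
      have "fst b' \<noteq> fst b"
        using same_column_not_label_le[OF \<open>\<gamma> \<in> compositions\<close> e, of b' \<alpha>] sat Cons u lb by auto
      then have "fst b < fst b'"
        using lb by (cases b; cases b') (auto simp: label_le_def)
      then have "column b' < column b"
        using edge_column(1)[OF \<open>\<gamma> \<in> compositions\<close> e] neg[of u] Cons u by simp
      then show ?thesis using srt Cons u by auto
    qed simp
  next
    assume lt: "\<forall>t\<in>set \<omega>. column (fst t) < column b"
    show "\<forall>t\<in>set \<omega>. label_le b (fst t)"
    proof
      fix t assume t: "t \<in> set \<omega>"
      then have "fst b < fst (fst t)"
        using lt neg[OF t] edge_column(1)[OF \<open>\<gamma> \<in> compositions\<close> e] by simp
      then show "label_le b (fst t)"
        by (cases b; cases "fst t") (auto simp: label_le_def)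
    qed
  qed
  then show ?case
    using Cons.IH[OF \<beta> sat] s by auto
qed simp

lemma saturated_chain_columns:
  assumes "\<gamma> \<in> compositions" "saturated_chain edge_dual_C \<gamma> \<omega>" "s \<in> set \<omega>"
  shows "column (fst s) \<le> sum_list \<gamma>"
  using assms
proof (induction \<omega> arbitrary: \<gamma>)
  case (Cons t \<omega>)
  obtain b \<beta> where t: "t = (b, \<beta>)" by fastforce
  have e: "edge_dual_C \<gamma> b \<beta>" using Cons.prems t by simp
  show ?case
  proof (cases "s = t")
    case True
    then show ?thesis using edge_column(2)[OF Cons.prems(1) e] t by simp
  next
    case False
    then show ?thesis
      using Cons.IH[OF edge_dual_C_in_compositions[OF e]] Cons.prems t edge_dual_C_sum_list[OF e]
      by simp
  qed
qed simp

lemma descent_chains_eq_strips: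
  assumes "\<gamma> \<in> compositions" "sum_list \<gamma> < c"
  shows "descent_chains edge_dual_C label_le a \<gamma> = strips a c \<gamma>"
  using assms sorted_labels_iff_sorted_columns[OF assms(1)] saturated_chain_columns[OF assms(1)]
  unfolding descent_chains_def strips_def by fastforce

lemma strips_0: "strips 0 c \<gamma> = {[]}"
  by (auto simp: strips_def)

lemma strips_Suc:
  "strips (Suc a) c \<gamma> = (\<lambda>(s, \<omega>). s # \<omega>) `
     (SIGMA (b, \<beta>):{(b, \<beta>). edge_dual_C \<gamma> b \<beta> \<and> column b < c}. strips a (column b) \<beta>)"
  (is "_ = ?f ` ?S")
proof (intro subset_antisym subsetI)
  fix \<omega> assume w: "\<omega> \<in> strips (Suc a) c \<gamma>"
  then obtain b \<beta> \<omega>' where "\<omega> = (b, \<beta>) # \<omega>'"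
    by (cases \<omega>) (auto simp: strips_def)
  then have "((b, \<beta>), \<omega>') \<in> ?S" "\<omega> = ?f ((b, \<beta>), \<omega>')"
    using w by (auto simp: strips_def)
  then show "\<omega> \<in> ?f ` ?S" by blast
next
  fix \<omega> assume "\<omega> \<in> ?f ` ?S"
  then show "\<omega> \<in> strips (Suc a) c \<gamma>"
    by (force simp: strips_def)
qed

lemma finite_bounded_edges:
  "\<gamma> \<in> compositions \<Longrightarrow> finite {(b, \<beta>). edge_dual_C \<gamma> b \<beta> \<and> column b < c}"
  by (rule finite_subset[OF _ finite_edges]) auto

lemma finite_strips: "\<gamma> \<in> compositions \<Longrightarrow> finite (strips a c \<gamma>)"
proof (induction a arbitrary: c \<gamma>)
  case (Suc a)
  show ?case
    unfolding strips_Suc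
    by (intro finite_imageI finite_SigmaI finite_bounded_edges Suc.prems)
      (auto intro: Suc.IH edge_dual_C_in_compositions)
qed (simp add: strips_0)

lemma sum_strips_Suc:
  assumes "\<gamma> \<in> compositions"
  shows "(\<Sum>\<omega>\<in>strips (Suc a) c \<gamma>. f (chain_end \<gamma> \<omega>)) =
    (\<Sum>(b, \<beta>) | edge_dual_C \<gamma> b \<beta> \<and> column b < c. \<Sum>\<omega>\<in>strips a (column b) \<beta>. f (chain_end \<beta> \<omega>))"
proof -
  let ?E = "{(b, \<beta>). edge_dual_C \<gamma> b \<beta> \<and> column b < c}"
  have "(\<Sum>\<omega>\<in>strips (Suc a) c \<gamma>. f (chain_end \<gamma> \<omega>)) =
    (\<Sum>(s, \<omega>)\<in>(SIGMA (b, \<beta>):?E. strips a (column b) \<beta>). f (chain_end \<gamma> (s # \<omega>)))"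
    unfolding strips_Suc by (subst sum.reindex) (auto simp: inj_on_def o_def case_prod_unfold)
  also have "\<dots> = (\<Sum>s\<in>?E. \<Sum>\<omega>\<in>(case s of (b, \<beta>) \<Rightarrow> strips a (column b) \<beta>). f (chain_end \<gamma> (s # \<omega>)))"
    by (rule sum.Sigma[symmetric])
      (use assms in \<open>auto intro: finite_bounded_edges finite_strips edge_dual_C_in_compositions\<close>)
  also have "\<dots> = (\<Sum>(b, \<beta>)\<in>?E. \<Sum>\<omega>\<in>strips a (column b) \<beta>. f (chain_end \<beta> \<omega>))"
    by (rule sum.cong) auto
  finally show ?thesis .
qed

text \<open>Every step deletes one cell, so only finitely many \<open>\<alpha>\<close> and \<open>\<beta>\<close> give a nonzero entry.\<close>

lemma chain_count_nonzero:
  assumes "\<gamma> \<in> compositions" "chain_count edge_dual_C label_le \<alpha> \<gamma> \<beta> \<noteq> 0"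
  shows "\<beta> \<in> compositions \<and> sum_list \<gamma> = sum_list \<alpha> + sum_list \<beta>"
  using assms
proof (induction \<alpha> arbitrary: \<gamma>)
  case Nil
  then show ?case by (auto simp: chain_count_Nil split: if_splits)
next
  case (Cons a \<alpha>)
  then obtain \<omega> where w: "\<omega> \<in> descent_chains edge_dual_C label_le a \<gamma>"
    "chain_count edge_dual_C label_le \<alpha> (chain_end \<gamma> \<omega>) \<beta> \<noteq> 0"
    unfolding chain_count_Cons by (meson sum.neutral)
  then show ?case
    using chain_end_composition[OF Cons.prems(1)] Cons.IH[of "chain_end \<gamma> \<omega>"]
    by (auto simp: descent_chains_def)
qed

section \<open>Tableaux in cartesian coordinates\<close>

text \<open>SSCTs with columns listed first and rows numbered from the bottom, which reverses the comparisons
  of rows.  Entries vanish exactly off the diagram, so \<open>T c > 0\<close> says that \<open>c\<close> is a cell; in the last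
  condition the strict inequality thus includes that \<open>(k + 1, j')\<close> is a cell.\<close>

definition cartesian_tableaux :: "nat list \<Rightarrow> (nat \<times> nat \<Rightarrow> nat) set" where
  "cartesian_tableaux \<gamma> = {T.
     (\<forall>c. 0 < T c \<longleftrightarrow> c \<in> cartesian_diagram \<gamma>) \<and>
     (\<forall>k j. 1 \<le> k \<longrightarrow> T (Suc k, j) \<le> T (k, j)) \<and>
     (\<forall>j j'. j < j' \<and> 0 < T (1, j) \<and> 0 < T (1, j') \<longrightarrow> T (1, j') < T (1, j)) \<and>
     (\<forall>k j j'. j < j' \<and> 0 < T (Suc k, j) \<and> T (Suc k, j) \<le> T (k, j')
        \<longrightarrow> T (Suc k, j) < T (Suc k, j'))}"

definition content :: "nat list \<Rightarrow> (nat \<times> nat \<Rightarrow> nat) \<Rightarrow> monomial" where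
  "content \<gamma> T = (\<Sum>c\<in>cartesian_diagram \<gamma>. Poly_Mapping.single (T c) 1)"

lemma cartesian_tableauxI:
  assumes "\<And>k j. 0 < T (k, j) \<longleftrightarrow> (k, j) \<in> cartesian_diagram \<gamma>"
    and "\<And>k j. 1 \<le> k \<Longrightarrow> T (Suc k, j) \<le> T (k, j)"
    and "\<And>j j'. j < j' \<Longrightarrow> 0 < T (1, j) \<Longrightarrow> 0 < T (1, j') \<Longrightarrow> T (1, j') < T (1, j)"
    and "\<And>k j j'. j < j' \<Longrightarrow> 0 < T (Suc k, j) \<Longrightarrow> T (Suc k, j) \<le> T (k, j') \<Longrightarrow>
      T (Suc k, j) < T (Suc k, j')"
  shows "T \<in> cartesian_tableaux \<gamma>"
  unfolding cartesian_tableaux_def using assms by simp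

lemma cartesian_tableauxD:
  assumes "T \<in> cartesian_tableaux \<gamma>"
  shows "0 < T (k, j) \<longleftrightarrow> (k, j) \<in> cartesian_diagram \<gamma>"
    and "1 \<le> k \<Longrightarrow> T (Suc k, j) \<le> T (k, j)"
    and "j < j' \<Longrightarrow> 0 < T (1, j) \<Longrightarrow> 0 < T (1, j') \<Longrightarrow> T (1, j') < T (1, j)"
    and "j < j' \<Longrightarrow> 0 < T (Suc k, j) \<Longrightarrow> T (Suc k, j) \<le> T (k, j') \<Longrightarrow>
      T (Suc k, j) < T (Suc k, j')"
  using assms unfolding cartesian_tableaux_def by auto

lemma finite_cartesian_diagram: "finite (cartesian_diagram \<gamma>)"
proof (rule finite_subset)
  show "cartesian_diagram \<gamma> \<subseteq> {..sum_list \<gamma>} \<times> {..length \<gamma>}"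
  proof (rule subrelI)
    fix k j assume "(k, j) \<in> cartesian_diagram \<gamma>"
    then have "1 \<le> k" "k \<le> row \<gamma> j" by (auto simp: cartesian_diagram_iff)
    then show "(k, j) \<in> {..sum_list \<gamma>} \<times> {..length \<gamma>}"
      using row_le_sum_list[of \<gamma> j] by (auto simp: row_def split: if_splits)
  qed
qed simp

lemma lookup_content:
  "Poly_Mapping.lookup (content \<gamma> T) v = card {c \<in> cartesian_diagram \<gamma>. T c = v}"
  unfolding content_def by (rule lookup_sum_single[OF finite_cartesian_diagram])

lemma keys_content: "Poly_Mapping.keys (content \<gamma> T) = T ` cartesian_diagram \<gamma>"
  by (auto simp: in_keys_iff lookup_content card_eq_0_iff finite_cartesian_diagram image_iff; metis)

lemma finite_cartesian_tableaux: "finite {T \<in> cartesian_tableaux \<gamma>. content \<gamma> T = m}"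
proof (rule finite_subset)
  show "{T \<in> cartesian_tableaux \<gamma>. content \<gamma> T = m} \<subseteq>
    {T. \<forall>c. (c \<in> cartesian_diagram \<gamma> \<longrightarrow> T c \<in> Poly_Mapping.keys m) \<and> (c \<notin> cartesian_diagram \<gamma> \<longrightarrow> T c = 0)}"
    using keys_content[of \<gamma>] cartesian_tableauxD(1)[of _ \<gamma>] by force
qed (intro finite_set_of_finite_funs finite_cartesian_diagram finite_keys)

lemma SSCT_D:
  assumes "T \<in> SSCT \<alpha>"
  shows "0 < T c \<longleftrightarrow> c \<in> diagram \<alpha>"
    and "(i, k) \<in> diagram \<alpha> \<Longrightarrow> (i, k + 1) \<in> diagram \<alpha> \<Longrightarrow> T (i, k + 1) \<le> T (i, k)"
    and "(i, 1) \<in> diagram \<alpha> \<Longrightarrow> (j, 1) \<in> diagram \<alpha> \<Longrightarrow> i < j \<Longrightarrow> T (i, 1) < T (j, 1)"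
    and "i < j \<Longrightarrow> (i, k) \<in> diagram \<alpha> \<Longrightarrow> (j, k + 1) \<in> diagram \<alpha> \<Longrightarrow> T (j, k + 1) \<le> T (i, k) \<Longrightarrow>
      T (j, k + 1) < T (i, k + 1)"
proof -
  note D = assms[unfolded SSCT_def mem_Collect_eq]
  show "0 < T c \<longleftrightarrow> c \<in> diagram \<alpha>" using D by (metis less_irrefl)
qed (use assms in \<open>unfold SSCT_def, blast+\<close>)

text \<open>The change of coordinates \<open>i \<mapsto> length \<gamma> + 1 - i\<close> on rows is an involution of the rows of the diagram,
  and truncated subtraction keeps all other rows outside the diagram.\<close>

lemma qsym_schur_eq_card_cartesian:
  "qsym_schur \<gamma> m = int (card {T \<in> cartesian_tableaux \<gamma>. content \<gamma> T = m})"
proof -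
  define n where "n = length \<gamma>"
  define g :: "nat \<times> nat \<Rightarrow> nat \<times> nat" where "g = (\<lambda>(i, k). (k, n + 1 - i))"
  define flip where "flip = (\<lambda>(T :: nat \<times> nat \<Rightarrow> nat) (k, j). T (n + 1 - j, k))"
  define unflip where "unflip = (\<lambda>(T :: nat \<times> nat \<Rightarrow> nat) (i, k). T (k, n + 1 - i))"
  have cd: "(k, j) \<in> cartesian_diagram \<gamma> \<longleftrightarrow> (n + 1 - j, k) \<in> diagram \<gamma>" if "j \<le> n + 1" for k j
    using that by (auto simp: cartesian_diagram_iff diagram_def row_def n_def)
  have out: "(k, j) \<notin> cartesian_diagram \<gamma>" if "\<not> (1 \<le> j \<and> j \<le> n)" for k j
    using that by (auto simp: cartesian_diagram_iff row_def n_def)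
  have outd: "(i, k) \<notin> diagram \<gamma>" if "\<not> (1 \<le> i \<and> i \<le> n)" for k i
    using that by (auto simp: diagram_def n_def)
  have cd': "(k, j) \<in> cartesian_diagram \<gamma> \<longleftrightarrow> (n + 1 - j, k) \<in> diagram \<gamma>" for k j
    using cd[of j k] out[of j k] outd[of "n + 1 - j" k] by (cases "j \<le> n + 1") auto
  have dc: "(i, k) \<in> diagram \<gamma> \<longleftrightarrow> (k, n + 1 - i) \<in> cartesian_diagram \<gamma>" for i k
  proof (cases "1 \<le> i \<and> i \<le> n")
    case True
    then show ?thesis using cd'[of k "n + 1 - i"] by auto
  next
    case False
    then have "\<not> (1 \<le> n + 1 - i \<and> n + 1 - i \<le> n)" by arith
    then show ?thesis using out outd[OF False] by blast
  qed
  have content_flip: "content \<gamma> (flip T) = (\<Sum>c\<in>diagram \<gamma>. Poly_Mapping.single (T c) 1)" for T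
  proof -
    have "inj_on g (diagram \<gamma>)"
      by (auto simp: inj_on_def g_def diagram_def n_def)
    then have "content \<gamma> (flip T) = (\<Sum>c\<in>diagram \<gamma>. Poly_Mapping.single (flip T (g c)) 1)"
      unfolding content_def cartesian_diagram_def g_def n_def by (subst sum.reindex) (auto simp: o_def)
    also have "\<dots> = (\<Sum>c\<in>diagram \<gamma>. Poly_Mapping.single (T c) 1)"
      by (rule sum.cong) (auto simp: flip_def g_def diagram_def n_def)
    finally show ?thesis .
  qed
  have flip: "flip T \<in> cartesian_tableaux \<gamma>" if T: "T \<in> SSCT \<gamma>" for T
  proof (rule cartesian_tableauxI)
    note D = SSCT_D[OF T]
    show pos: "0 < flip T (k, j) \<longleftrightarrow> (k, j) \<in> cartesian_diagram \<gamma>" for k j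
      using D(1) cd' by (simp add: flip_def)
    show "flip T (Suc k, j) \<le> flip T (k, j)" if "1 \<le> k" for k j
    proof (cases "0 < flip T (Suc k, j)")
      case True
      then have "(Suc k, j) \<in> cartesian_diagram \<gamma>" "(k, j) \<in> cartesian_diagram \<gamma>"
        using pos that by (auto simp: cartesian_diagram_iff)
      then show ?thesis using D(2)[of "n + 1 - j" k] cd' by (simp add: flip_def)
    qed simp
    show "flip T (1, j') < flip T (1, j)" if "j < j'" "0 < flip T (1, j)" "0 < flip T (1, j')" for j j'
    proof -
      have "(1, j) \<in> cartesian_diagram \<gamma>" "(1, j') \<in> cartesian_diagram \<gamma>"
        using pos that by auto
      moreover from this have "n + 1 - j' < n + 1 - j" using out[of j' 1] that(1) by (cases "j' \<le> n") auto
      ultimately show ?thesis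
        using D(3)[of "n + 1 - j'" "n + 1 - j"] cd' by (simp add: flip_def)
    qed
    show "flip T (Suc k, j) < flip T (Suc k, j')"
      if "j < j'" "0 < flip T (Suc k, j)" "flip T (Suc k, j) \<le> flip T (k, j')" for k j j'
    proof -
      have "(k, j') \<in> cartesian_diagram \<gamma>" "(Suc k, j) \<in> cartesian_diagram \<gamma>"
        using pos[of k j'] pos[of "Suc k" j] that(2,3) by linarith+
      moreover from this have "n + 1 - j' < n + 1 - j" using out[of j' k] that(1) by (cases "j' \<le> n") auto
      ultimately show ?thesis
        using D(4)[of "n + 1 - j'" "n + 1 - j" k] cd' that(3) by (simp add: flip_def)
    qed
  qed
  have unflip: "unflip T \<in> SSCT \<gamma>" if T: "T \<in> cartesian_tableaux \<gamma>" for T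
  proof -
    note D = cartesian_tableauxD[OF T]
    have pos: "0 < unflip T (i, k) \<longleftrightarrow> (i, k) \<in> diagram \<gamma>" for i k
      using D(1) dc by (simp add: unflip_def)
    have "unflip T (i, k + 1) \<le> unflip T (i, k)" if "(i, k) \<in> diagram \<gamma>" for i k
      using D(2)[of k "n + 1 - i"] that by (simp add: unflip_def diagram_def)
    moreover have "unflip T (i, 1) < unflip T (j, 1)"
      if "(i, 1) \<in> diagram \<gamma>" "(j, 1) \<in> diagram \<gamma>" "i < j" for i j
    proof -
      have "n + 1 - j < n + 1 - i" using that(3) outd[of j 1] that(2) by (cases "j \<le> n") auto
      then show ?thesis
        using D(3)[of "n + 1 - j" "n + 1 - i"] pos[of i 1] pos[of j 1] that
        by (simp add: unflip_def)
    qed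
    moreover have "(i, k + 1) \<in> diagram \<gamma> \<and> unflip T (j, k + 1) < unflip T (i, k + 1)"
      if "i < j" "(i, k) \<in> diagram \<gamma>" "(j, k + 1) \<in> diagram \<gamma>" "unflip T (j, k + 1) \<le> unflip T (i, k)" for i j k
    proof -
      have "n + 1 - j < n + 1 - i" using that(1) outd[of j "k + 1"] that(3) by (cases "j \<le> n") auto
      then have "unflip T (j, k + 1) < unflip T (i, k + 1)"
        using D(4)[of "n + 1 - j" "n + 1 - i" k] pos[of j "k + 1"] that
        by (simp add: unflip_def)
      moreover from this have "0 < unflip T (i, k + 1)" by simp
      ultimately show ?thesis using pos by blast
    qed
    moreover have "\<forall>c. c \<in> diagram \<gamma> \<longrightarrow> unflip T c > 0" "\<forall>c. c \<notin> diagram \<gamma> \<longrightarrow> unflip T c = 0"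
      using pos by (auto simp: split_paired_all)
    ultimately show ?thesis unfolding SSCT_def by blast
  qed
  have unflip_flip: "unflip (flip T) = T" if "T \<in> SSCT \<gamma>" for T
  proof (rule ext)
    fix c :: "nat \<times> nat" obtain i k where c: "c = (i, k)" by fastforce
    have "T (i', k) = 0" if "(i', k) \<notin> diagram \<gamma>" for i'
      using SSCT_D(1)[OF \<open>T \<in> SSCT \<gamma>\<close>] that by (metis gr0I)
    then show "unflip (flip T) c = T c"
      using outd[of i k] outd[of "n + 1 - (n + 1 - i)" k] unfolding c
      by (cases "i \<le> n + 1") (auto simp: unflip_def flip_def)
  qed
  have flip_unflip: "flip (unflip T) = T" if "T \<in> cartesian_tableaux \<gamma>" for T
  proof (rule ext)
    fix c :: "nat \<times> nat" obtain k j where c: "c = (k, j)" by fastforce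
    have "T (k, j') = 0" if "(k, j') \<notin> cartesian_diagram \<gamma>" for j'
      using cartesian_tableauxD(1)[OF \<open>T \<in> cartesian_tableaux \<gamma>\<close>] that by (metis gr0I)
    then show "flip (unflip T) c = T c"
      using out[of j k] out[of "n + 1 - (n + 1 - j)" k] unfolding c
      by (cases "j \<le> n + 1") (auto simp: unflip_def flip_def)
  qed
  have "bij_betw flip {T \<in> SSCT \<gamma>. (\<Sum>c\<in>diagram \<gamma>. Poly_Mapping.single (T c) 1) = m}
      {T \<in> cartesian_tableaux \<gamma>. content \<gamma> T = m}"
  proof (rule bij_betw_byWitness[where f' = unflip])
    show "unflip ` {T \<in> cartesian_tableaux \<gamma>. content \<gamma> T = m} \<subseteq>
        {T \<in> SSCT \<gamma>. (\<Sum>c\<in>diagram \<gamma>. Poly_Mapping.single (T c) 1) = m}"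
    proof (rule image_subsetI)
      fix T assume "T \<in> {T \<in> cartesian_tableaux \<gamma>. content \<gamma> T = m}"
      then show "unflip T \<in> {T \<in> SSCT \<gamma>. (\<Sum>c\<in>diagram \<gamma>. Poly_Mapping.single (T c) 1) = m}"
        using unflip[of T] flip_unflip[of T] content_flip[of "unflip T"] by simp
    qed
  qed (use flip unflip_flip flip_unflip content_flip in auto)
  then show ?thesis
    unfolding qsym_schur_def by (simp add: bij_betw_same_card)
qed

section \<open>Deleting the smallest entries of a tableau\<close>

lemma cartesian_diagram_remove:
  assumes "removable \<gamma> k j" "row \<beta> = (row \<gamma>)(j := k - 1)"
  shows "cartesian_diagram \<gamma> = insert (k, j) (cartesian_diagram \<beta>)" "(k, j) \<notin> cartesian_diagram \<beta>"
  using assms by (auto simp: cartesian_diagram_iff removable_def split: if_splits)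

lemma content_remove:
  assumes "removable \<gamma> k j" "row \<beta> = (row \<gamma>)(j := k - 1)"
  shows "content \<gamma> T = Poly_Mapping.single (T (k, j)) 1 + content \<beta> (T((k, j) := w))"
proof -
  have "(\<Sum>c\<in>cartesian_diagram \<beta>. Poly_Mapping.single ((T((k, j) := w)) c) (1::nat))
      = (\<Sum>c\<in>cartesian_diagram \<beta>. Poly_Mapping.single (T c) 1)"
    by (rule sum.cong) (use cartesian_diagram_remove(2)[OF assms] in auto)
  then show ?thesis
    unfolding content_def cartesian_diagram_remove(1)[OF assms]
    using cartesian_diagram_remove(2)[OF assms] by (simp add: finite_cartesian_diagram)
qed

text \<open>Since all entries equal to the new smallest value \<open>v\<close> are in columns left of \<open>k\<close>, every entry in
  column \<open>k\<close> or further right exceeds \<open>v\<close>.  The triple condition with the new cell as the smaller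
  entry then reduces to the existence of the cell \<open>(k, j')\<close> to the right of \<open>(k - 1, j')\<close>, which
  removability provides; with the new cell in one of the other two positions the hypotheses of the
  condition are never met.\<close>

lemma cartesian_tableau_insert:
  assumes "removable \<gamma> k j" "row \<beta> = (row \<gamma>)(j := k - 1)"
    and T: "T \<in> cartesian_tableaux \<beta>" and "0 < v"
    and min: "\<And>c. 0 < T c \<Longrightarrow> v \<le> T c"
    and left: "\<And>k' j'. T (k', j') = v \<Longrightarrow> k' < k"
  shows "T((k, j) := v) \<in> cartesian_tableaux \<gamma>" (is "?T \<in> _")
proof -
  note D = cartesian_tableauxD[OF T]
  note cells = cartesian_diagram_remove[OF assms(1,2)]
  have row: "1 \<le> k" "row \<gamma> j = k" using assms(1) by (auto simp: removable_def)
  have T0: "T (k', j) = 0" if "k \<le> k'" for k'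
    using D(1)[of k' j] that row by (auto simp: cartesian_diagram_iff assms(2))
  have big: "v < T (k', j')" if "0 < T (k', j')" "k \<le> k'" for k' j'
    using min[OF that(1)] left[of k' j'] that(2) by force
  show ?thesis
  proof (rule cartesian_tableauxI)
    show "0 < ?T (k', j') \<longleftrightarrow> (k', j') \<in> cartesian_diagram \<gamma>" for k' j'
      using D(1)[of k' j'] \<open>0 < v\<close> by (auto simp: cells(1))
  next
    fix k' j' assume "1 \<le> (k' :: nat)"
    show "?T (Suc k', j') \<le> ?T (k', j')"
    proof (cases "(Suc k', j') = (k, j)")
      case True
      then have "(k', j) \<in> cartesian_diagram \<beta>"
        using \<open>1 \<le> k'\<close> row by (auto simp: cartesian_diagram_iff assms(2))
      then show ?thesis using min D(1) True by auto
    next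
      case False
      then show ?thesis using D(2)[OF \<open>1 \<le> k'\<close>, of j'] T0[of "Suc k'"] by auto
    qed
  next
    fix j1 j2 assume j: "j1 < j2" "0 < ?T (1, j1)" "0 < ?T (1, j2)"
    show "?T (1, j2) < ?T (1, j1)"
    proof (cases "k = 1")
      case True
      have "T (1, j') = 0" if "j < j'" for j'
        using that assms(1) D(1)[of 1 j'] True
        by (auto simp: removable_def cartesian_diagram_iff assms(2))
      then show ?thesis
        using True j D(3)[of j1 j2] big[of 1 j1] by (auto split: if_splits)
    next
      case False
      then show ?thesis using j D(3)[of j1 j2] by simp
    qed
  next
    fix k' j1 j2
    assume a: "j1 < j2" "0 < ?T (Suc k', j1)" "?T (Suc k', j1) \<le> ?T (k', j2)"
    show "?T (Suc k', j1) < ?T (Suc k', j2)"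
    proof (cases "(Suc k', j1) = (k, j)")
      case True
      then have pos: "0 < T (k', j2)" using a by (auto split: if_splits)
      then have "(k', j2) \<in> cartesian_diagram \<beta>" using D(1) by blast
      then have "1 \<le> k'" "k' \<le> row \<gamma> j2"
        using a(1) True by (auto simp: cartesian_diagram_iff assms(2))
      moreover have "row \<gamma> j2 \<noteq> k'"
        using assms(1) a(1) True \<open>1 \<le> k'\<close> by (auto simp: removable_def split: if_splits)
      ultimately have "(k, j2) \<in> cartesian_diagram \<beta>"
        using a(1) True by (auto simp: cartesian_diagram_iff assms(2))
      then have "v < T (k, j2)" using big D(1) by blast
      then show ?thesis using a(1) True by auto
    next
      case False
      then have pos: "0 < T (Suc k', j1)" "?T (Suc k', j1) = T (Suc k', j1)" using a(2) by auto
      have "(k', j2) \<noteq> (k, j)"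
      proof
        \<comment> \<open>An entry in column \<open>k + 1\<close> exceeds \<open>v\<close>, so the new cell cannot be the left cell of a triple.\<close>
        assume "(k', j2) = (k, j)"
        then have "T (Suc k', j1) \<le> v" "k \<le> Suc k'" using a(3) pos(2) by auto
        then show False using big[of "Suc k'" j1] pos(1) by simp
      qed
      then have eq: "?T (k', j2) = T (k', j2)" by (rule fun_upd_other)
      have "T (Suc k', j1) < T (Suc k', j2)"
        using D(4)[OF a(1) pos(1)] a(3) unfolding pos(2) eq .
      moreover from this have "(Suc k', j2) \<noteq> (k, j)" using T0[of k] by auto
      ultimately show ?thesis unfolding pos(2) by (metis fun_upd_other)
    qed
  qed
qed

text \<open>The rightmost cell \<open>(k, j)\<close> with the smallest value \<open>v\<close> ends its row, because a cell to its right
  would also hold \<open>v\<close>.  A row of length \<open>k - 1\<close> above it would violate the triple condition, and so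
  would a second entry \<open>v\<close> in its column; in the first column strictness takes over.\<close>

lemma cartesian_tableau_delete:
  assumes T: "T \<in> cartesian_tableaux \<gamma>" and v: "0 < v" "T (k, j) = v"
    and smallest: "\<forall>c. 0 < T c \<longrightarrow> v \<le> T c"
    and rightmost: "\<forall>k' j'. T (k', j') = v \<longrightarrow> k' \<le> k"
  shows "removable \<gamma> k j"
    and "row \<beta> = (row \<gamma>)(j := k - 1) \<Longrightarrow> T((k, j) := 0) \<in> cartesian_tableaux \<beta>"
    and "T (k', j') = v \<Longrightarrow> (k', j') \<noteq> (k, j) \<Longrightarrow> k' < k"
proof -
  note min = smallest[rule_format] and right = rightmost[rule_format]
  note D = cartesian_tableauxD[OF T]
  have cell: "1 \<le> k" "k \<le> row \<gamma> j" using D(1)[of k j] v by (auto simp: cartesian_diagram_iff)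
  have D1: "0 < T (k', j') \<longleftrightarrow> 1 \<le> k' \<and> k' \<le> row \<gamma> j'" for k' j'
    using D(1)[of k' j'] by (simp add: cartesian_diagram_iff)
  have right_end: "row \<gamma> j = k"
  proof (rule ccontr)
    assume "row \<gamma> j \<noteq> k"
    then have "0 < T (Suc k, j)" using D1 cell by simp
    then have "T (Suc k, j) = v" using min[of "(Suc k, j)"] D(2)[OF cell(1), of j] v(2) by simp
    then show False using right by fastforce
  qed
  have above: "if k = 1 then row \<gamma> j' = 0 else row \<gamma> j' \<noteq> k - 1" if "j < j'" for j'
  proof (cases "k = 1")
    case True
    have "\<not> 0 < T (1, j')" using D(3)[OF that] min[of "(1, j')"] v True by fastforce
    then show ?thesis using D1[of 1 j'] True by auto
  next
    case False
    then have k: "Suc (k - 1) = k" using cell by simp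
    have "row \<gamma> j' \<noteq> k - 1"
    proof
      assume r: "row \<gamma> j' = k - 1"
      then have "0 < T (k - 1, j')" using D1 False cell(1) by simp
      then have "T (k, j) < T (k, j')" using D(4)[OF that, of "k - 1"] min k v by simp
      then have "0 < T (k, j')" by simp
      then show False using D1 r cell(1) by simp
    qed
    then show ?thesis using False by simp
  qed
  show rem: "removable \<gamma> k j" unfolding removable_def using cell(1) right_end above by blast
  have distinct: "T (k, j2) \<noteq> v" if "j1 < j2" "T (k, j1) = v" for j1 j2
  proof
    assume v2: "T (k, j2) = v"
    show False
    proof (cases "k = 1")
      case True
      then show False using D(3)[OF that(1)] that(2) v2 v(1) by simp
    next
      case False
      then have k: "Suc (k - 1) = k" "1 \<le> k - 1" using cell by auto
      then have "T (k, j1) \<le> T (k - 1, j2)" using D(2)[OF k(2), of j2] that(2) v2 k(1) by simp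
      then show False using D(4)[OF that(1), of "k - 1"] k(1) that(2) v2 v(1) by simp
    qed
  qed
  show "k' < k" if "T (k', j') = v" "(k', j') \<noteq> (k, j)"
  proof -
    have "k' \<noteq> k"
    proof
      assume "k' = k"
      then have "j' < j \<or> j < j'" "T (k, j') = v" using that by auto
      then show False using v(2) distinct by blast
    qed
    then show ?thesis using right[OF that(1)] by simp
  qed
  show "T((k, j) := 0) \<in> cartesian_tableaux \<beta>" (is "?T \<in> _") if r: "row \<beta> = (row \<gamma>)(j := k - 1)"
  proof (rule cartesian_tableauxI)
    note cells = cartesian_diagram_remove[OF rem r]
    show "0 < ?T (k', j') \<longleftrightarrow> (k', j') \<in> cartesian_diagram \<beta>" for k' j'
      using D(1)[of k' j'] cells by auto
    show "?T (Suc k', j') \<le> ?T (k', j')" if "1 \<le> k'" for k' j'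
      using D(2)[OF that, of j'] D1[of "Suc k" j] right_end by auto
    show "?T (1, j2) < ?T (1, j1)" if "j1 < j2" "0 < ?T (1, j1)" "0 < ?T (1, j2)" for j1 j2
      using D(3)[OF that(1)] that by (auto split: if_splits)
    show "?T (Suc k', j1) < ?T (Suc k', j2)"
      if a: "j1 < j2" "0 < ?T (Suc k', j1)" "?T (Suc k', j1) \<le> ?T (k', j2)" for k' j1 j2
    proof -
      have pos: "0 < T (Suc k', j1)" "?T (Suc k', j1) = T (Suc k', j1)"
        using a(2) by (auto split: if_splits)
      then have lt: "T (Suc k', j1) < T (Suc k', j2)"
        using D(4)[OF a(1) pos(1)] a(3) by (auto split: if_splits)
      moreover have "(Suc k', j2) \<noteq> (k, j)"
      proof
        assume "(Suc k', j2) = (k, j)"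
        then show False using lt v(2) min[OF pos(1)] by auto
      qed
      ultimately show ?thesis unfolding pos(2) by (metis fun_upd_other)
    qed
  qed
qed

text \<open>The tableaux with \<open>a\<close> entries equal to \<open>v\<close>, all in columns before \<open>c\<close>; the remaining entries are
  recorded by \<open>m\<close>, which is meant to involve only variables beyond \<open>v\<close>.\<close>

definition min_tableaux :: "nat \<Rightarrow> nat \<Rightarrow> monomial \<Rightarrow> nat \<Rightarrow> nat list \<Rightarrow> (nat \<times> nat \<Rightarrow> nat) set" where
  "min_tableaux v a m c \<gamma> = {T \<in> cartesian_tableaux \<gamma>.
     content \<gamma> T = Poly_Mapping.single v a + m \<and> (\<forall>k j. T (k, j) = v \<longrightarrow> k < c)}"

lemma min_tableaux_ge:
  assumes "T \<in> min_tableaux v a m c \<gamma>" "Poly_Mapping.keys m \<subseteq> {v<..}" "0 < T p"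
  shows "v \<le> T p"
proof -
  have "p \<in> cartesian_diagram \<gamma>"
    using assms(1,3) cartesian_tableauxD(1)[of T \<gamma> "fst p" "snd p"] by (simp add: min_tableaux_def)
  then have "T p \<in> Poly_Mapping.keys (Poly_Mapping.single v a + m)"
    using assms(1) keys_content[of \<gamma> T] by (auto simp: min_tableaux_def)
  also have "\<dots> \<subseteq> {v} \<union> {v<..}"
    using Poly_Mapping.keys_add[of "Poly_Mapping.single v a" m] assms(2) by (auto split: if_splits)
  finally show ?thesis by auto
qed

text \<open>The column of the last deleted cell becomes the bound for the next one, exactly as for \<open>strips\<close>; this
  makes the decomposition unique, the deleted cell being the rightmost one that holds \<open>v\<close>.\<close>

lemma bij_betw_min_tableaux:
  assumes \<gamma>: "\<gamma> \<in> compositions" and v: "0 < v" and m: "Poly_Mapping.keys m \<subseteq> {v<..}"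
  shows "bij_betw (\<lambda>((b, \<beta>), T). T((column b, nat (- snd b)) := v))
    (SIGMA (b, \<beta>):{(b, \<beta>). edge_dual_C \<gamma> b \<beta> \<and> column b < c}. min_tableaux v a m (column b) \<beta>)
    (min_tableaux v (Suc a) m c \<gamma>)" (is "bij_betw ?f ?S _")
  unfolding bij_betw_def
proof
  have S: "\<exists>k j. b = (- int k, - int j) \<and> column b = k \<and> nat (- snd b) = j \<and> removable \<gamma> k j \<and>
      \<beta> \<in> compositions \<and> row \<beta> = (row \<gamma>)(j := k - 1) \<and> k < c \<and> T \<in> min_tableaux v a m k \<beta> \<and>
      T (k, j) = 0"
    if p: "((b, \<beta>), T) \<in> ?S" for b \<beta> T
  proof -
    obtain k j where kj: "b = (- int k, - int j)" "removable \<gamma> k j" "\<beta> \<in> compositions"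
      "row \<beta> = (row \<gamma>)(j := k - 1)"
      using p edge_dual_C_iff[OF \<gamma>, of b \<beta>] by auto
    moreover have T: "T \<in> min_tableaux v a m k \<beta>" "k < c"
      using p kj(1) by (auto simp: column_def)
    moreover have "T (k, j) = 0"
      using cartesian_diagram_remove(2)[OF kj(2,4)] cartesian_tableauxD(1)[of T \<beta> k j] T(1)
      by (simp add: min_tableaux_def)
    ultimately show ?thesis by (simp add: column_def)
  qed
  show "inj_on ?f ?S"
  proof (rule inj_onI)
    fix p q assume p: "p \<in> ?S" and q: "q \<in> ?S" and eq: "?f p = ?f q"
    obtain b \<beta> T where p': "p = ((b, \<beta>), T)" by (metis surj_pair)
    obtain b' \<beta>' T' where q': "q = ((b', \<beta>'), T')" by (metis surj_pair)
    obtain k j where P: "b = (- int k, - int j)" "column b = k" "nat (- snd b) = j" "\<beta> \<in> compositions"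
      "row \<beta> = (row \<gamma>)(j := k - 1)" "T \<in> min_tableaux v a m k \<beta>" "T (k, j) = 0"
      using S p p' by blast
    obtain k' j' where Q: "b' = (- int k', - int j')" "column b' = k'" "nat (- snd b') = j'" "\<beta>' \<in> compositions"
      "row \<beta>' = (row \<gamma>)(j' := k' - 1)" "T' \<in> min_tableaux v a m k' \<beta>'" "T' (k', j') = 0"
      using S q q' by blast
    have fe: "T((k, j) := v) = T'((k', j') := v)" using eq p' q' P(2,3) Q(2,3) by simp
    have "(k, j) = (k', j')"
    proof (rule ccontr)
      \<comment> \<open>Otherwise each of the two inserted cells would lie strictly to the left of the other.\<close>
      assume ne: "(k, j) \<noteq> (k', j')"
      have "T' (k, j) = v" using fun_cong[OF fe, of "(k, j)"] ne by (simp split: if_splits)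
      moreover have "T (k', j') = v" using fun_cong[OF fe, of "(k', j')"] ne by (simp split: if_splits)
      ultimately have "k < k'" "k' < k" using P(6) Q(6) by (auto simp: min_tableaux_def)
      then show False by simp
    qed
    moreover from this have "T = T'"
      using fe P(7) Q(7) by (metis fun_upd_triv fun_upd_upd)
    moreover have "\<beta> = \<beta>'" using row_eqD P(4,5) Q(4,5) calculation(1) by simp
    ultimately show "p = q" using p' q' P(1) Q(1) by simp
  qed
  show "?f ` ?S = min_tableaux v (Suc a) m c \<gamma>"
  proof (intro subset_antisym subsetI)
    fix U assume "U \<in> ?f ` ?S"
    then obtain b \<beta> T where p: "((b, \<beta>), T) \<in> ?S" "U = ?f ((b, \<beta>), T)" by auto
    obtain k j where P: "column b = k" "nat (- snd b) = j" "removable \<gamma> k j"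
      "row \<beta> = (row \<gamma>)(j := k - 1)" "k < c" "T \<in> min_tableaux v a m k \<beta>" "T (k, j) = 0"
      using S[OF p(1)] by blast
    have U: "U = T((k, j) := v)" using p(2) P(1,2) by simp
    have "U \<in> cartesian_tableaux \<gamma>"
      unfolding U using P(6) min_tableaux_ge[OF P(6) m]
      by (intro cartesian_tableau_insert[OF P(3,4) _ v]) (auto simp: min_tableaux_def)
    moreover have "content \<gamma> U = Poly_Mapping.single v 1 + content \<beta> T"
      using content_remove[OF P(3,4), of U 0] P(7) by (simp add: U fun_upd_idem)
    then have "content \<gamma> U = Poly_Mapping.single v (Suc a) + m"
      using P(6) by (simp add: min_tableaux_def single_add[symmetric] add.assoc[symmetric])
    moreover have "k' < c" if "U (k', j') = v" for k' j'
      using that P(5,6) unfolding U by (force simp: min_tableaux_def split: if_splits)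
    ultimately show "U \<in> min_tableaux v (Suc a) m c \<gamma>" unfolding min_tableaux_def by blast
  next
    fix U assume U: "U \<in> min_tableaux v (Suc a) m c \<gamma>"
    have Uc: "U \<in> cartesian_tableaux \<gamma>" "content \<gamma> U = Poly_Mapping.single v (Suc a) + m"
      and left: "\<And>k j. U (k, j) = v \<Longrightarrow> k < c"
      using U by (auto simp: min_tableaux_def)
    have "v \<in> Poly_Mapping.keys (content \<gamma> U)"
      by (simp add: Uc(2) in_keys_iff lookup_add)
    then have ex: "\<exists>k j. U (k, j) = v" unfolding keys_content by auto
    \<comment> \<open>The cell to be deleted is the one in the last column that contains \<open>v\<close>.\<close>
    define k where "k = (GREATEST k. \<exists>j. U (k, j) = v)"
    have bound: "k \<le> c" if "\<exists>j. U (k, j) = v" for k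
      using that left less_imp_le by blast
    have "\<exists>j. U (k, j) = v"
      unfolding k_def by (rule GreatestI_ex_nat[where b = c]) (use ex bound in blast)+
    then obtain j where kj: "U (k, j) = v" ..
    have "k' \<le> k" if "U (k', j') = v" for k' j'
      unfolding k_def by (rule Greatest_le_nat[where b = c]) (use that bound in blast)+
    then have right: "\<forall>k' j'. U (k', j') = v \<longrightarrow> k' \<le> k" by blast
    have ge: "\<forall>p. 0 < U p \<longrightarrow> v \<le> U p" using min_tableaux_ge[OF U m] by blast
    note del = cartesian_tableau_delete[OF Uc(1) v kj ge right]
    obtain \<beta> where \<beta>: "covers_C \<gamma> \<beta>" "row \<beta> = (row \<gamma>)(j := k - 1)"
      using removable_covers[OF \<gamma> del(1)] by blast
    define b where "b = (- int k, - int j)"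
    have e: "edge_dual_C \<gamma> b \<beta>"
      using edge_dual_C_iff[OF \<gamma>] del(1) \<beta> covers_in_compositions b_def by blast
    define T where "T = U((k, j) := 0)"
    have "Poly_Mapping.single v (Suc a) + m = Poly_Mapping.single v 1 + content \<beta> T"
      using content_remove[OF del(1) \<beta>(2), of U 0] Uc(2) kj by (simp add: T_def)
    moreover have "Poly_Mapping.single v (Suc a) + m = Poly_Mapping.single v 1 + (Poly_Mapping.single v a + m)"
      by (simp add: single_add[symmetric] add.assoc[symmetric])
    ultimately have "content \<beta> T = Poly_Mapping.single v a + m" by simp
    moreover have "k' < k" if "T (k', j') = v" for k' j'
      using that v del(3) by (auto simp: T_def split: if_splits)
    moreover have "T \<in> cartesian_tableaux \<beta>" unfolding T_def by (rule del(2)[OF \<beta>(2)])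
    moreover have "column b = k" by (simp add: b_def column_def)
    ultimately have "T \<in> min_tableaux v a m (column b) \<beta>" unfolding min_tableaux_def by blast
    then have "((b, \<beta>), T) \<in> ?S"
      using e left[OF kj] by (simp add: b_def column_def)
    moreover have "U = ?f ((b, \<beta>), T)"
      using kj by (simp add: T_def b_def column_def fun_upd_idem)
    ultimately show "U \<in> ?f ` ?S" by (rule rev_image_eqI)
  qed
qed

lemma card_min_tableaux:
  assumes "\<gamma> \<in> compositions" "0 < v" "Poly_Mapping.keys m \<subseteq> {v<..}"
  shows "card (min_tableaux v a m c \<gamma>) =
    (\<Sum>\<omega>\<in>strips a c \<gamma>. card {T \<in> cartesian_tableaux (chain_end \<gamma> \<omega>). content (chain_end \<gamma> \<omega>) T = m})"
  using assms(1)
proof (induction a arbitrary: c \<gamma>)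
  case 0
  have "T (k, j) \<noteq> v" if "T \<in> cartesian_tableaux \<gamma>" "content \<gamma> T = m" for T k j
  proof
    assume "T (k, j) = v"
    then have "v \<in> Poly_Mapping.keys (content \<gamma> T)"
      using cartesian_tableauxD(1)[OF that(1), of k j] assms(2) unfolding keys_content by force
    then show False using that(2) assms(3) by auto
  qed
  then have "min_tableaux v 0 m c \<gamma> = {T \<in> cartesian_tableaux \<gamma>. content \<gamma> T = m}"
    by (auto simp: min_tableaux_def)
  then show ?case by (simp add: strips_0)
next
  case (Suc a)
  let ?E = "{(b, \<beta>). edge_dual_C \<gamma> b \<beta> \<and> column b < c}"
  have fin: "finite (min_tableaux v a m c' \<beta>)" for c' \<beta>
    by (rule finite_subset[OF _ finite_cartesian_tableaux[of \<beta> "Poly_Mapping.single v a + m"]])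
      (auto simp: min_tableaux_def)
  have "card (min_tableaux v (Suc a) m c \<gamma>) =
      card (SIGMA (b, \<beta>):?E. min_tableaux v a m (column b) \<beta>)"
    using bij_betw_same_card[OF bij_betw_min_tableaux[OF Suc.prems assms(2,3)]] by simp
  also have "\<dots> = (\<Sum>(b, \<beta>)\<in>?E. card (min_tableaux v a m (column b) \<beta>))"
    using finite_bounded_edges[OF Suc.prems, of c] fin
    by (subst card_SigmaI) (auto intro!: sum.cong)
  also have "\<dots> = (\<Sum>(b, \<beta>)\<in>?E. \<Sum>\<omega>\<in>strips a (column b) \<beta>.
      card {T \<in> cartesian_tableaux (chain_end \<beta> \<omega>). content (chain_end \<beta> \<omega>) T = m})"
    by (rule sum.cong) (auto simp: Suc.IH dest: edge_dual_C_in_compositions)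
  also have "\<dots> = (\<Sum>\<omega>\<in>strips (Suc a) c \<gamma>.
      card {T \<in> cartesian_tableaux (chain_end \<gamma> \<omega>). content (chain_end \<gamma> \<omega>) T = m})"
    by (rule sum_strips_Suc[OF Suc.prems, symmetric])
  finally show ?case .
qed

text \<open>Columns never exceed the size of \<open>\<gamma>\<close>, so with a larger bound \<open>c\<close> the column condition is void.\<close>

lemma card_tableaux_split_minimum:
  assumes "\<gamma> \<in> compositions" "0 < v" "Poly_Mapping.keys m \<subseteq> {v<..}"
  shows "card {T \<in> cartesian_tableaux \<gamma>. content \<gamma> T = Poly_Mapping.single v a + m} =
    (\<Sum>\<omega>\<in>descent_chains edge_dual_C label_le a \<gamma>.
       card {T \<in> cartesian_tableaux (chain_end \<gamma> \<omega>). content (chain_end \<gamma> \<omega>) T = m})"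
proof -
  have "k < Suc (sum_list \<gamma>)" if "T \<in> cartesian_tableaux \<gamma>" "T (k, j) = v" for T k j
  proof -
    have "k \<le> row \<gamma> j"
      using cartesian_tableauxD(1)[OF that(1), of k j] that(2) assms(2) by (simp add: cartesian_diagram_iff)
    then show ?thesis using row_le_sum_list[of \<gamma> j] by simp
  qed
  then have "{T \<in> cartesian_tableaux \<gamma>. content \<gamma> T = Poly_Mapping.single v a + m} =
      min_tableaux v a m (Suc (sum_list \<gamma>)) \<gamma>"
    by (auto simp: min_tableaux_def)
  then show ?thesis
    using card_min_tableaux[OF assms] descent_chains_eq_strips[OF assms(1), of "Suc (sum_list \<gamma>)"]
    by simp
qed

lemma power_product_Cons:
  "power_product (v # vs) (a # \<alpha>) = Poly_Mapping.single v a + power_product vs \<alpha>"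
  unfolding power_product_def by (simp add: sum.lessThan_Suc_shift del: sum.lessThan_Suc)

lemma cartesian_diagram_empty_imp_Nil:
  assumes "\<gamma> \<in> compositions" "cartesian_diagram \<gamma> = {}"
  shows "\<gamma> = []"
proof (rule ccontr)
  assume "\<gamma> \<noteq> []"
  then have "0 < row \<gamma> 1" using row_pos_iff[OF assms(1), of 1] by (simp add: Suc_le_eq)
  then have "(1, 1) \<in> cartesian_diagram \<gamma>" by (simp add: cartesian_diagram_iff)
  then show False using assms(2) by simp
qed

lemma card_tableaux_content_0:
  assumes "\<gamma> \<in> compositions"
  shows "card {T \<in> cartesian_tableaux \<gamma>. content \<gamma> T = 0} = (if \<gamma> = [] then 1 else 0)"
proof (cases "\<gamma> = []")
  case True
  have "cartesian_diagram [] = {}" by (auto simp: cartesian_diagram_iff row_Nil)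
  then have "{T \<in> cartesian_tableaux []. content [] T = 0} = {\<lambda>_. 0}"
    by (auto simp: cartesian_tableaux_def content_def fun_eq_iff)
  then show ?thesis using True by simp
next
  case False
  have "content \<gamma> T \<noteq> 0" for T
    using cartesian_diagram_empty_imp_Nil[OF assms] False keys_content[of \<gamma> T] by auto
  then show ?thesis using False by simp
qed

text \<open>The variables \<open>is\<close> do not enter the right-hand side: quasisymmetry of \<open>S_\<gamma>\<close> is part of the
  conclusion.  The induction removes the variables in increasing order, since the smallest entries of
  a tableau come off first.\<close>

lemma qsym_schur_power_product:
  assumes "\<gamma> \<in> compositions" "\<alpha> \<in> compositions" "is \<in> index_lists (length \<alpha>)"
  shows "qsym_schur \<gamma> (power_product is \<alpha>) = chain_count edge_dual_C label_le \<alpha> \<gamma> []"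
  unfolding qsym_schur_eq_card_cartesian using assms
proof (induction \<alpha> arbitrary: "is" \<gamma>)
  case Nil
  then show ?case
    by (simp add: power_product_def card_tableaux_content_0 chain_count_Nil)
next
  case (Cons a \<alpha>)
  obtain v vs where is_eq: "is = v # vs" using Cons.prems(3) by (cases "is") (auto simp: index_lists_def)
  have v: "0 < v" and vs: "vs \<in> index_lists (length \<alpha>)" "set vs \<subseteq> {v<..}"
    using Cons.prems(3) by (auto simp: index_lists_def is_eq)
  have \<alpha>: "\<alpha> \<in> compositions" using Cons.prems(2) by (simp add: compositions_def)
  have "Poly_Mapping.keys (power_product vs \<alpha>) \<subseteq> {v<..}"
    using keys_power_product[OF vs(1) \<alpha>] vs(2) by simp
  note split = card_tableaux_split_minimum[OF Cons.prems(1) v this, of a]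
  have "chain_end \<gamma> \<omega> \<in> compositions" if "\<omega> \<in> descent_chains edge_dual_C label_le a \<gamma>" for \<omega>
    using that chain_end_composition[OF Cons.prems(1)] by (simp add: descent_chains_def)
  then show ?case
    unfolding is_eq power_product_Cons split chain_count_Cons of_nat_sum
    using Cons.IH[OF _ \<alpha> vs(1)] by (intro sum.cong) auto
qed

section \<open>Quasisymmetric Schur functions as chain enumerators\<close>

lemma index_list_upt: "[1..<r + 1] \<in> index_lists r"
  by (auto simp: index_lists_def simp del: upt_Suc)

lemma zero_in_keys_qsym_schur:
  assumes "0 \<in> Poly_Mapping.keys m"
  shows "qsym_schur \<gamma> m = 0"
proof -
  have "0 \<notin> Poly_Mapping.keys (content \<gamma> T)" if "T \<in> cartesian_tableaux \<gamma>" for T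
    using cartesian_tableauxD(1)[OF that] unfolding keys_content by force
  then have empty: "{T \<in> cartesian_tableaux \<gamma>. content \<gamma> T = m} = {}"
    using assms by blast
  show ?thesis unfolding qsym_schur_eq_card_cartesian empty by simp
qed

lemma qsym_schur_eq:
  assumes "\<gamma> \<in> compositions"
  shows "qsym_schur \<gamma> m =
    (if 0 \<in> Poly_Mapping.keys m then 0 else chain_count edge_dual_C label_le (exponents m) \<gamma> [])"
proof (cases "0 \<in> Poly_Mapping.keys m")
  case False
  then show ?thesis
    using qsym_schur_power_product[OF assms exponents_in_compositions sorted_keys_in_index_lists[OF False]]
    by (simp add: power_product_exponents)
qed (simp add: zero_in_keys_qsym_schur)

lemma K_interval_dual_C:
  assumes "\<gamma> \<in> compositions"
  shows "K_interval edge_dual_C label_le \<gamma> \<beta> m =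
    (if 0 \<in> Poly_Mapping.keys m then 0 else chain_count edge_dual_C label_le (exponents m) \<gamma> \<beta>)"
proof (rule K_interval_eq)
  show "finite {\<alpha> \<in> compositions. chain_count edge_dual_C label_le \<alpha> \<gamma> \<beta> \<noteq> 0}"
    by (rule finite_subset[OF _ finite_compositions_sum_le[of "sum_list \<gamma>"]])
      (use chain_count_nonzero[OF assms] in auto)
qed

lemma K_interval_nonzero:
  assumes "\<gamma> \<in> compositions" "K_interval edge_dual_C label_le \<gamma> \<beta> m \<noteq> 0"
  shows "\<beta> \<in> compositions \<and> sum_list \<gamma> = degree m + sum_list \<beta>"
  using chain_count_nonzero[OF assms(1), of "exponents m" \<beta>] assms
  by (simp add: K_interval_dual_C degree_eq_sum_exponents split: if_splits)

lemma K_interval_in_QSym: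
  assumes "\<gamma> \<in> compositions"
  shows "K_interval edge_dual_C label_le \<gamma> \<beta> \<in> QSym"
proof -
  let ?K = "K_interval edge_dual_C label_le \<gamma> \<beta>"
  have "?K m = 0" if "0 \<in> Poly_Mapping.keys m" for m
    using that by (simp add: K_interval_dual_C[OF assms])
  moreover have "degree m \<le> sum_list \<gamma>" if "?K m \<noteq> 0" for m
    using K_interval_nonzero[OF assms that] by simp
  moreover have "?K (power_product is \<alpha>) = chain_count edge_dual_C label_le \<alpha> \<gamma> \<beta>"
    if "\<alpha> \<in> compositions" "is \<in> index_lists (length \<alpha>)" for \<alpha> "is"
  proof -
    have "0 \<notin> set is" using that(2) by (simp add: index_lists_def)
    then show ?thesis
      using keys_power_product[OF that(2,1)] exponents_power_product[OF that(2,1)]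
      by (simp add: K_interval_dual_C[OF assms])
  qed
  ultimately show ?thesis unfolding QSym_def by (auto intro!: exI[of _ "sum_list \<gamma>"])
qed

text \<open>Among all \<open>\<alpha>\<close> and all factorisations of \<open>\<alpha>\<close>, only the one into the exponent sequences of \<open>m\<close> and \<open>n\<close>
  contributes at \<open>(m, n)\<close>.\<close>

lemma coproduct_qsym_schur:
  assumes \<gamma>: "\<gamma> \<in> compositions"
  shows "coproduct (qsym_schur \<gamma>) (m, n) =
    (if 0 \<in> Poly_Mapping.keys m \<or> 0 \<in> Poly_Mapping.keys n then 0
     else chain_count edge_dual_C label_le (exponents m @ exponents n) \<gamma> [])"
proof -
  let ?c = "\<lambda>\<alpha>. chain_count edge_dual_C label_le \<alpha> \<gamma> []"
  let ?ok = "0 \<notin> Poly_Mapping.keys m \<and> 0 \<notin> Poly_Mapping.keys n"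
  let ?A = "{\<alpha> \<in> compositions. ?c \<alpha> \<noteq> 0}"
  have coeff: "monomial_coeff (qsym_schur \<gamma>) \<alpha> = ?c \<alpha>" if "\<alpha> \<in> compositions" for \<alpha>
    unfolding monomial_coeff_def
    using qsym_schur_power_product[OF \<gamma> that index_list_upt] by simp
  have fin: "finite ?A"
    by (rule finite_subset[OF _ finite_compositions_sum_le[of "sum_list \<gamma>"]])
      (use chain_count_nonzero[OF \<gamma>] in auto)
  have inner: "(\<Sum>(\<mu>, \<nu>) | \<mu> @ \<nu> = \<alpha>. tensor (monomial_qsym \<mu>) (monomial_qsym \<nu>) (m, n)) =
      (if exponents m @ exponents n = \<alpha> \<and> ?ok then 1 else 0)" if \<alpha>: "\<alpha> \<in> compositions" for \<alpha>
  proof -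
    have sub: "{(\<mu>, \<nu>). \<mu> @ \<nu> = \<alpha>} \<subseteq> (\<lambda>i. (take i \<alpha>, drop i \<alpha>)) ` {..length \<alpha>}"
    proof (rule subrelI)
      fix \<mu> \<nu> assume "(\<mu>, \<nu>) \<in> {(\<mu>, \<nu>). \<mu> @ \<nu> = \<alpha>}"
      then show "(\<mu>, \<nu>) \<in> (\<lambda>i. (take i \<alpha>, drop i \<alpha>)) ` {..length \<alpha>}"
        by (intro image_eqI[of _ _ "length \<mu>"]) auto
    qed
    then have "finite {(\<mu>, \<nu>). \<mu> @ \<nu> = \<alpha>}" by (rule finite_subset) simp
    moreover have "(\<Sum>(\<mu>, \<nu>) | \<mu> @ \<nu> = \<alpha>. tensor (monomial_qsym \<mu>) (monomial_qsym \<nu>) (m, n)) =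
      (\<Sum>p | fst p @ snd p = \<alpha>. if p = (exponents m, exponents n) then (if ?ok then 1 else 0) else 0)"
    proof (rule sum.cong)
      fix p assume "p \<in> {p. fst p @ snd p = \<alpha>}"
      then have "fst p \<in> compositions" "snd p \<in> compositions"
        using \<alpha> by (auto simp: compositions_def)
      then show "(case p of (\<mu>, \<nu>) \<Rightarrow> tensor (monomial_qsym \<mu>) (monomial_qsym \<nu>) (m, n)) =
          (if p = (exponents m, exponents n) then (if ?ok then 1 else 0) else 0)"
        by (cases p) (auto simp: tensor_def monomial_qsym_eq)
    qed auto
    ultimately show ?thesis by (simp add: case_prod_unfold)
  qed
  have "coproduct (qsym_schur \<gamma>) (m, n) =
      (\<Sum>\<alpha>\<in>?A. if exponents m @ exponents n = \<alpha> then (if ?ok then ?c \<alpha> else 0) else 0)"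
    unfolding coproduct_def
  proof (rule sum.cong)
    show "{\<alpha> \<in> compositions. monomial_coeff (qsym_schur \<gamma>) \<alpha> \<noteq> 0} = ?A"
      using coeff by auto
    show "monomial_coeff (qsym_schur \<gamma>) \<alpha> *
        (\<Sum>(\<mu>, \<nu>) | \<mu> @ \<nu> = \<alpha>. tensor (monomial_qsym \<mu>) (monomial_qsym \<nu>) (m, n)) =
        (if exponents m @ exponents n = \<alpha> then (if ?ok then ?c \<alpha> else 0) else 0)" if "\<alpha> \<in> ?A" for \<alpha>
      using that coeff inner[of \<alpha>] by auto
  qed
  also have "\<dots> = (if exponents m @ exponents n \<in> ?A then (if ?ok then ?c (exponents m @ exponents n) else 0) else 0)"
    using fin by simp
  finally show ?thesis
    using exponents_in_compositions[of m] exponents_in_compositions[of n]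
    by (auto simp: compositions_def)
qed

text \<open>The chains counted by the coefficient of \<open>M_\<mu> \<otimes> M_\<nu>\<close> are cut at the element \<open>\<beta>\<close> where the part
  belonging to \<open>\<mu>\<close> ends.\<close>

lemma coproduct_qsym_schur_K:
  assumes \<gamma>: "\<gamma> \<in> compositions" and "finite Z" "\<And>\<beta>. \<beta> \<in> Z \<Longrightarrow> \<beta> \<in> compositions"
    and Z: "\<And>\<beta>. K_interval edge_dual_C label_le \<gamma> \<beta> \<noteq> (\<lambda>_. 0) \<Longrightarrow> \<beta> \<in> Z"
  shows "coproduct (qsym_schur \<gamma>) =
    (\<lambda>mn. \<Sum>\<beta>\<in>Z. tensor (K_interval edge_dual_C label_le \<gamma> \<beta>) (qsym_schur \<beta>) mn)"
proof (rule ext, clarify)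
  fix m n
  have terms: "tensor (K_interval edge_dual_C label_le \<gamma> \<beta>) (qsym_schur \<beta>) (m, n) =
      (if 0 \<in> Poly_Mapping.keys m \<or> 0 \<in> Poly_Mapping.keys n then 0
       else chain_count edge_dual_C label_le (exponents m) \<gamma> \<beta> *
            chain_count edge_dual_C label_le (exponents n) \<beta> [])" if "\<beta> \<in> Z" for \<beta>
    using assms(3)[OF that] by (simp add: tensor_def K_interval_dual_C[OF \<gamma>] qsym_schur_eq)
  have split: "chain_count edge_dual_C label_le (exponents m @ exponents n) \<gamma> [] =
      (\<Sum>\<beta>\<in>Z. chain_count edge_dual_C label_le (exponents m) \<gamma> \<beta> *
            chain_count edge_dual_C label_le (exponents n) \<beta> [])" if "0 \<notin> Poly_Mapping.keys m"
  proof (rule chain_count_append[OF assms(2)])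
    fix \<beta> assume "chain_count edge_dual_C label_le (exponents m) \<gamma> \<beta> \<noteq> 0"
    then have "K_interval edge_dual_C label_le \<gamma> \<beta> m \<noteq> 0"
      using that by (simp add: K_interval_dual_C[OF \<gamma>])
    then show "\<beta> \<in> Z" using Z by force
  qed
  show "coproduct (qsym_schur \<gamma>) (m, n) =
      (\<Sum>\<beta>\<in>Z. tensor (K_interval edge_dual_C label_le \<gamma> \<beta>) (qsym_schur \<beta>) (m, n))"
    using split by (simp add: coproduct_qsym_schur[OF \<gamma>] terms)
qed

section \<open>Linear independence of the quasisymmetric Schur functions\<close>

lemma SSCT_zero: "T \<in> SSCT \<alpha> \<Longrightarrow> c \<notin> diagram \<alpha> \<Longrightarrow> T c = 0"
  using SSCT_D(1)[of T \<alpha> c] by simp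

lemma finite_diagram: "finite (diagram \<alpha>)"
proof (rule finite_subset)
  show "diagram \<alpha> \<subseteq> (SIGMA i:{..length \<alpha>}. {..\<alpha> ! (i - 1)})"
    by (auto simp: diagram_def)
qed auto

lemma lookup_power_product_upt:
  "Poly_Mapping.lookup (power_product [1..<length \<alpha> + 1] \<alpha>) v =
    (if 1 \<le> v \<and> v \<le> length \<alpha> then \<alpha> ! (v - 1) else 0)"
proof (cases "1 \<le> v \<and> v \<le> length \<alpha>")
  case True
  then have "v - 1 < length \<alpha>" by linarith
  then show ?thesis
    using lookup_power_product_nth[of "[1..<length \<alpha> + 1]" \<alpha> "v - 1"] True by (simp del: upt_Suc)
next
  case False
  then show ?thesis
    using lookup_power_product_notin[of "[1..<length \<alpha> + 1]" \<alpha> v] by (auto simp del: upt_Suc)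
qed

definition row_filling :: "nat list \<Rightarrow> nat \<times> nat \<Rightarrow> nat" where
  "row_filling \<alpha> = (\<lambda>(i, k). if (i, k) \<in> diagram \<alpha> then i else 0)"

lemma row_filling_SSCT: "row_filling \<alpha> \<in> SSCT \<alpha>"
  by (auto simp: SSCT_def row_filling_def diagram_def)

lemma card_diagram_row:
  assumes "1 \<le> i" "i \<le> length \<alpha>"
  shows "card {c \<in> diagram \<alpha>. fst c = i} = \<alpha> ! (i - 1)"
proof -
  have "{c \<in> diagram \<alpha>. fst c = i} = Pair i ` {1..\<alpha> ! (i - 1)}"
    using assms by (auto simp: diagram_def)
  then show ?thesis by (simp add: card_image inj_on_def)
qed

lemma content_row_filling:
  "(\<Sum>c\<in>diagram \<alpha>. Poly_Mapping.single (row_filling \<alpha> c) 1) = power_product [1..<length \<alpha> + 1] \<alpha>"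
proof (rule poly_mapping_eqI)
  fix v
  have "{c \<in> diagram \<alpha>. row_filling \<alpha> c = v} = {c \<in> diagram \<alpha>. fst c = v}"
    by (auto simp: row_filling_def)
  moreover have "card {c \<in> diagram \<alpha>. fst c = v} = 0" if "\<not> (1 \<le> v \<and> v \<le> length \<alpha>)"
    using that by (auto simp: diagram_def card_eq_0_iff)
  ultimately show "Poly_Mapping.lookup (\<Sum>c\<in>diagram \<alpha>. Poly_Mapping.single (row_filling \<alpha> c) 1) v =
      Poly_Mapping.lookup (power_product [1..<length \<alpha> + 1] \<alpha>) v"
    unfolding lookup_sum_single[OF finite_diagram] lookup_power_product_upt
    using card_diagram_row[of v \<alpha>] by auto
qed

lemma SSCT_row_antimono:
  assumes "T \<in> SSCT \<alpha>" "(i, k) \<in> diagram \<alpha>"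
  shows "T (i, k) \<le> T (i, 1)"
proof -
  have "1 \<le> k" using assms(2) by (simp add: diagram_def)
  then show ?thesis using assms(2)
  proof (induction k rule: dec_induct)
    case (step k)
    then have "(i, k) \<in> diagram \<alpha>" by (auto simp: diagram_def)
    then show ?case using step SSCT_D(2)[OF assms(1), of i k] by simp
  qed simp
qed

lemma lenlex_nth_lessI:
  assumes "length xs = length ys" "i < length xs" "\<And>j. j < i \<Longrightarrow> xs ! j = ys ! j" "xs ! i < ys ! i"
  shows "(xs, ys) \<in> lenlex less_than"
proof -
  have "take i xs = take i ys" using assms by (intro nth_equalityI) auto
  then have "xs = take i xs @ xs ! i # drop (Suc i) xs" "ys = take i xs @ ys ! i # drop (Suc i) ys"
    using id_take_nth_drop[of i xs] id_take_nth_drop[of i ys] assms(1,2) by presburger+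
  then show ?thesis using assms(1,4) unfolding lenlex_conv lex_conv by force
qed

text \<open>The first column is strictly increasing with values among the \<open>length \<beta>\<close> variables, so
  \<open>length \<alpha> \<le> length \<beta>\<close>, and for equal lengths its entry in row \<open>i\<close> is \<open>i\<close>.  Then row \<open>i\<close> has entries at
  most \<open>i\<close>.  As long as the earlier parts of \<open>\<alpha>\<close> and \<open>\<beta>\<close> agree, the earlier rows use up all the smaller
  values, so row \<open>i\<close> is filled with \<open>i\<close> and \<open>\<alpha>_i \<le> \<beta>_i\<close>.\<close>

lemma SSCT_leading_content:
  assumes \<alpha>: "\<alpha> \<in> compositions" and T: "T \<in> SSCT \<alpha>"
    and content: "(\<Sum>c\<in>diagram \<alpha>. Poly_Mapping.single (T c) 1) = power_product [1..<length \<beta> + 1] \<beta>"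
  shows "(\<alpha>, \<beta>) \<in> lenlex less_than \<or> \<alpha> = \<beta> \<and> T = row_filling \<alpha>"
proof -
  note D = SSCT_D[OF T]
  have count: "card {c \<in> diagram \<alpha>. T c = v} = (if 1 \<le> v \<and> v \<le> length \<beta> then \<beta> ! (v - 1) else 0)" for v
    using lookup_sum_single[OF finite_diagram, of T \<alpha> v] unfolding content lookup_power_product_upt by simp
  have vals: "1 \<le> T c \<and> T c \<le> length \<beta>" if "c \<in> diagram \<alpha>" for c
  proof (rule ccontr)
    assume "\<not> ?thesis"
    then have "card {c' \<in> diagram \<alpha>. T c' = T c} = 0" using count[of "T c"] by presburger
    then have "{c' \<in> diagram \<alpha>. T c' = T c} = {}" by (simp add: finite_diagram del: split_paired_All)
    then show False using that by blast
  qed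
  have first: "(i, 1) \<in> diagram \<alpha>" if "1 \<le> i" "i \<le> length \<alpha>" for i
  proof -
    have "\<alpha> ! (i - 1) \<in> set \<alpha>" using that by (intro nth_mem) simp
    then have "\<alpha> ! (i - 1) \<noteq> 0" using \<alpha> by (metis compositions_def mem_Collect_eq)
    then show ?thesis using that by (simp add: diagram_def Suc_le_eq)
  qed
  have mono: "T (i, 1) < T (j, 1)" if "1 \<le> i" "i < j" "j \<le> length \<alpha>" for i j
    using D(3) first that by simp
  \<comment> \<open>Lower and upper bounds of a strictly increasing sequence in \<open>{1..length \<beta>}\<close>.\<close>
  have ge: "i \<le> T (i, 1)" if "1 \<le> i" "i \<le> length \<alpha>" for i
    using that
  proof (induction i rule: dec_induct)
    case base
    then show ?case using vals first by simp
  next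
    case (step i)
    then show ?case using mono[of i "Suc i"] by simp
  qed
  have le: "T (i, 1) + (length \<alpha> - i) \<le> length \<beta>" if "1 \<le> i" "i \<le> length \<alpha>" for i
    using that(2,1)
  proof (induction i rule: inc_induct)
    case base
    then show ?case using vals[OF first] by simp
  next
    case (step i)
    then show ?case using mono[of i "Suc i"] by simp
  qed
  have "length \<alpha> \<le> length \<beta>" using ge[of "length \<alpha>"] le[of "length \<alpha>"] by (cases "length \<alpha> = 0") auto
  then consider "length \<alpha> < length \<beta>" | (eq) "length \<alpha> = length \<beta>" by linarith
  then show ?thesis
  proof cases
    case eq
    have col1: "T (i, 1) = i" if "1 \<le> i" "i \<le> length \<alpha>" for i
      using ge[OF that] le[OF that] eq that by linarith
    have upper: "T (i, k) \<le> i" if "(i, k) \<in> diagram \<alpha>" for i k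
      using SSCT_row_antimono[OF T that] col1[of i] that by (simp add: diagram_def)
    have full: "T (i, k) = i"
      if "(i, k) \<in> diagram \<alpha>" "\<And>j. j < i - 1 \<Longrightarrow> \<alpha> ! j = \<beta> ! j" for i k
      using that
    proof (induction i arbitrary: k rule: less_induct)
      case (less i)
      have i: "1 \<le> i" "i \<le> length \<alpha>" using less.prems(1) by (auto simp: diagram_def)
      have "\<not> T (i, k) < i"
      proof
        assume lt: "T (i, k) < i"
        \<comment> \<open>By induction the \<open>\<beta>_j = \<alpha>_j\<close> entries \<open>j\<close> fill row \<open>j\<close>, so none is left for row \<open>i\<close>.\<close>
        define j where "j = T (i, k)"
        have j: "1 \<le> j" "j < i" using vals[OF less.prems(1)] lt by (auto simp: j_def)
        have "{c \<in> diagram \<alpha>. fst c = j} \<subseteq> {c \<in> diagram \<alpha>. T c = j}"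
          using less.IH[OF j(2)] less.prems(2) j by auto
        moreover have "card {c \<in> diagram \<alpha>. T c = j} = card {c \<in> diagram \<alpha>. fst c = j}"
          using count[of j] card_diagram_row[of j \<alpha>] less.prems(2)[of "j - 1"] j i eq by simp
        ultimately have "{c \<in> diagram \<alpha>. fst c = j} = {c \<in> diagram \<alpha>. T c = j}"
          by (intro card_subset_eq) (auto simp: finite_diagram)
        then have "fst (i, k) = j" using less.prems(1) j_def by blast
        then show False using j by simp
      qed
      then show ?case using upper[OF less.prems(1)] by simp
    qed
    show ?thesis
    proof (cases "\<alpha> = \<beta>")
      case True
      then have "T c = row_filling \<alpha> c" for c
        using full[of "fst c" "snd c"] SSCT_zero[OF T, of c] by (auto simp: row_filling_def split: prod.split)
      then show ?thesis using True by blast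
    next
      case False
      define i where "i = (LEAST i. i < length \<alpha> \<and> \<alpha> ! i \<noteq> \<beta> ! i)"
      have "\<exists>i. i < length \<alpha> \<and> \<alpha> ! i \<noteq> \<beta> ! i" using False eq by (metis nth_equalityI)
      then have i: "i < length \<alpha>" "\<alpha> ! i \<noteq> \<beta> ! i"
        unfolding i_def by (metis (mono_tags, lifting) LeastI_ex)+
      have agree: "\<alpha> ! j = \<beta> ! j" if "j < i" for j
        using not_less_Least[of j "\<lambda>i. i < length \<alpha> \<and> \<alpha> ! i \<noteq> \<beta> ! i"] that i(1) by (auto simp: i_def)
      have "{c \<in> diagram \<alpha>. fst c = Suc i} \<subseteq> {c \<in> diagram \<alpha>. T c = Suc i}"
        using full[of "Suc i"] agree by auto
      then have "card {c \<in> diagram \<alpha>. fst c = Suc i} \<le> card {c \<in> diagram \<alpha>. T c = Suc i}"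
        by (intro card_mono) (auto simp: finite_diagram)
      then have "\<alpha> ! i \<le> \<beta> ! i"
        using card_diagram_row[of "Suc i" \<alpha>] count[of "Suc i"] i(1) eq by simp
      then show ?thesis using lenlex_nth_lessI[OF eq i(1) agree] i(2) by simp
    qed
  qed (simp add: lenlex_conv)
qed

lemma qsym_schur_leading_coeff:
  assumes "\<alpha> \<in> compositions"
  shows "monomial_coeff (qsym_schur \<alpha>) \<alpha> = 1"
proof -
  have "T = row_filling \<alpha>"
    if "T \<in> SSCT \<alpha>" "(\<Sum>c\<in>diagram \<alpha>. Poly_Mapping.single (T c) 1) = power_product [1..<length \<alpha> + 1] \<alpha>" for T
    using SSCT_leading_content[OF assms that] wf_irrefl[OF wf_lenlex[OF wf_less_than]] by blast
  then have "{T \<in> SSCT \<alpha>. (\<Sum>c\<in>diagram \<alpha>. Poly_Mapping.single (T c) 1) =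
      power_product [1..<length \<alpha> + 1] \<alpha>} = {row_filling \<alpha>}"
    using row_filling_SSCT content_row_filling by blast
  then show ?thesis unfolding monomial_coeff_def qsym_schur_def by simp
qed

lemma qsym_schur_triangular:
  assumes "\<alpha> \<in> compositions" "monomial_coeff (qsym_schur \<alpha>) \<beta> \<noteq> 0"
  shows "(\<alpha>, \<beta>) \<in> lenlex less_than \<or> \<alpha> = \<beta>"
proof -
  have "{T \<in> SSCT \<alpha>. (\<Sum>c\<in>diagram \<alpha>. Poly_Mapping.single (T c) 1) =
      power_product [1..<length \<beta> + 1] \<beta>} \<noteq> {}" (is "?A \<noteq> {}")
  proof
    assume "?A = {}"
    then have "int (card ?A) = 0" by (metis card.empty of_nat_0)
    then show False using assms(2) unfolding monomial_coeff_def qsym_schur_def by blast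
  qed
  then show ?thesis using SSCT_leading_content[OF assms(1)] by blast
qed

text \<open>At the monomial with exponents \<open>\<beta>\<close> all terms above \<open>\<beta>\<close> vanish by triangularity, and those below by
  induction along the length-lexicographic well-order.\<close>

lemma qsym_schur_independent:
  assumes "finite Z" "Z \<subseteq> compositions" "\<And>m. (\<Sum>\<beta>\<in>Z. d \<beta> * qsym_schur \<beta> m) = 0" "\<beta> \<in> Z"
  shows "d \<beta> = 0"
  using wf_lenlex[OF wf_less_than] assms(4)
proof (induction \<beta> rule: wf_induct_rule)
  case (less \<beta>)
  have "(\<Sum>\<alpha>\<in>Z. d \<alpha> * monomial_coeff (qsym_schur \<alpha>) \<beta>) = (\<Sum>\<alpha>\<in>Z. if \<alpha> = \<beta> then d \<beta> else 0)"
  proof (rule sum.cong)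
    fix \<alpha> assume \<alpha>: "\<alpha> \<in> Z"
    show "d \<alpha> * monomial_coeff (qsym_schur \<alpha>) \<beta> = (if \<alpha> = \<beta> then d \<beta> else 0)"
      using less.IH[of \<alpha>] \<alpha> assms(2) qsym_schur_leading_coeff[of \<alpha>] qsym_schur_triangular[of \<alpha> \<beta>]
      by auto
  qed simp
  then show ?case
    using assms(3)[of "power_product [1..<length \<beta> + 1] \<beta>"] assms(1) less.prems
    by (simp add: monomial_coeff_def)
qed

section \<open>Skew families\<close>

text \<open>A skew family is required to vanish off the compositions.\<close>

definition K_family :: "nat list \<Rightarrow> nat list \<Rightarrow> series" where
  "K_family \<gamma> \<beta> = (if \<beta> \<in> compositions then K_interval edge_dual_C label_le \<gamma> \<beta> else (\<lambda>_. 0))"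

lemma is_skew_family_K:
  assumes \<gamma>: "\<gamma> \<in> compositions"
  shows "is_skew_family \<gamma> (K_family \<gamma>)"
proof -
  let ?Z = "{\<beta> \<in> compositions. K_family \<gamma> \<beta> \<noteq> (\<lambda>_. 0)}"
  have Z: "?Z = {\<beta>. K_family \<gamma> \<beta> \<noteq> (\<lambda>_. 0)}" by (auto simp: K_family_def)
  have "finite ?Z"
  proof (rule finite_subset[OF _ finite_compositions_sum_le[of "sum_list \<gamma>"]])
    show "?Z \<subseteq> {\<beta> \<in> compositions. sum_list \<beta> \<le> sum_list \<gamma>}"
    proof
      fix \<beta> assume "\<beta> \<in> ?Z"
      then obtain m where "\<beta> \<in> compositions" "K_interval edge_dual_C label_le \<gamma> \<beta> m \<noteq> 0"
        by (auto simp: K_family_def fun_eq_iff)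
      then show "\<beta> \<in> {\<beta> \<in> compositions. sum_list \<beta> \<le> sum_list \<gamma>}"
        using K_interval_nonzero[OF \<gamma>] by force
    qed
  qed
  moreover have "coproduct (qsym_schur \<gamma>) = (\<lambda>mn. \<Sum>\<beta>\<in>?Z. tensor (K_family \<gamma> \<beta>) (qsym_schur \<beta>) mn)"
  proof -
    have "\<beta> \<in> ?Z" if "K_interval edge_dual_C label_le \<gamma> \<beta> \<noteq> (\<lambda>_. 0)" for \<beta>
    proof -
      have "\<beta> \<in> compositions" using that K_interval_nonzero[OF \<gamma>] by blast
      then show ?thesis using that by (simp add: K_family_def)
    qed
    then have "coproduct (qsym_schur \<gamma>) =
        (\<lambda>mn. \<Sum>\<beta>\<in>?Z. tensor (K_interval edge_dual_C label_le \<gamma> \<beta>) (qsym_schur \<beta>) mn)"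
      using \<open>finite ?Z\<close> by (intro coproduct_qsym_schur_K[OF \<gamma>]) auto
    then show ?thesis by (simp add: K_family_def)
  qed
  ultimately show ?thesis
    unfolding is_skew_family_def Z
    using K_interval_in_QSym[OF \<gamma>] by (simp add: K_family_def)
qed

text \<open>For a fixed monomial in the first set of variables the two expansions are integer combinations of
  the \<open>S_\<beta>\<close> in the second set, so their coefficients agree.\<close>

lemma skew_family_unique:
  assumes F: "is_skew_family \<gamma> F" and G: "is_skew_family \<gamma> G"
  shows "F = G"
proof (intro ext)
  fix \<beta> m
  let ?Z = "{\<beta> \<in> compositions. F \<beta> \<noteq> (\<lambda>_. 0)} \<union> {\<beta> \<in> compositions. G \<beta> \<noteq> (\<lambda>_. 0)}"
  have fin: "finite ?Z"
    by (rule finite_subset[of _ "{\<beta>. F \<beta> \<noteq> (\<lambda>_. 0)} \<union> {\<beta>. G \<beta> \<noteq> (\<lambda>_. 0)}"])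
      (use F G in \<open>auto simp: is_skew_family_def\<close>)
  have expand: "coproduct (qsym_schur \<gamma>) (m, n) = (\<Sum>\<beta>\<in>?Z. H \<beta> m * qsym_schur \<beta> n)"
    if "is_skew_family \<gamma> H" "H = F \<or> H = G" for H n
  proof -
    have "coproduct (qsym_schur \<gamma>) (m, n) =
        (\<Sum>\<beta> | \<beta> \<in> compositions \<and> H \<beta> \<noteq> (\<lambda>_. 0). tensor (H \<beta>) (qsym_schur \<beta>) (m, n))"
      using that(1) by (simp add: is_skew_family_def)
    also have "\<dots> = (\<Sum>\<beta>\<in>?Z. tensor (H \<beta>) (qsym_schur \<beta>) (m, n))"
      by (rule sum.mono_neutral_left) (use fin that(2) in \<open>auto simp: tensor_def\<close>)
    finally show ?thesis by (simp add: tensor_def)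
  qed
  have zero: "(\<Sum>\<beta>\<in>?Z. (F \<beta> m - G \<beta> m) * qsym_schur \<beta> n) = 0" for n
    using expand[OF F] expand[OF G] by (simp add: left_diff_distrib sum_subtractf)
  show "F \<beta> m = G \<beta> m"
  proof (cases "\<beta> \<in> ?Z")
    case True
    have "F \<beta> m - G \<beta> m = 0"
      by (rule qsym_schur_independent[OF fin _ zero True]) auto
    then show ?thesis by simp
  next
    case False
    then show ?thesis using F G by (cases "\<beta> \<in> compositions") (auto simp: is_skew_family_def)
  qed
qed

theorem theorem5p13:
  fixes \<gamma> \<beta> :: "nat list"
  assumes "\<gamma> \<in> compositions" and "\<beta> \<in> compositions"
    and "le_dual_C \<gamma> \<beta>"
  shows "K_interval edge_dual_C label_le \<gamma> \<beta> = skew_qsym_schur \<gamma> \<beta>"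
proof -
  have "(THE F. is_skew_family \<gamma> F) = K_family \<gamma>"
    using is_skew_family_K[OF assms(1)] skew_family_unique by (intro the_equality)
  then show ?thesis
    using assms(2) by (simp add: skew_qsym_schur_def K_family_def)
qed

end
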